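(* Let $\epsilon>0$, $\Omega\ge 1$, $w(\Omega)=3\sqrt{\Omega}$, and let $T$ be a positive integer. Let $\{p_t\}_{t=1}^T$ with $p_t\in\mathcal{P}$ be a given sequence, and let $\{x_t\}_{t=1}^T$ be the sequence generated by the $\epsilon$-SMD update rule (defined in the context) with per-iteration sample size $K$ and diminishing step size $\alpha_{x,t}=c_x/\sqrt{t}$, where $c_x=\frac1G\sqrt{D_x/\Omega}$. Let $\theta\in\Delta_T$ be the normalization of $\{\alpha_{x,t}\}_{t=1}^T$, i.e. $\theta_t=\alpha_{x,t}/\sum_{s=1}^T\alpha_{x,s}$. Let $C_K\in[0,\frac12)$ and let $E$ be the event $$|\hat f_t^i(x)-f_t^i(x)|\le\frac{C_K\epsilon}{2}\qquad\forall x\in X,\ i\in[m],\ t\in[T].$$ Then $$\mathbb{P}\Big\{\epsilon^{\bullet}\le\frac{w(\Omega)\cdot G\cdot\ln(T)\cdot\sqrt{2D_x}}{\sqrt T}+C_K\epsilon\ \Big|\ E\Big\}\ge 1-2\exp(-\Omega).$$ Moreover, if $E$ holds with probability at least $1-\nu_1$ for some $\nu_1\in(0,1)$, then $$\mathbb{P}\Big\{\epsilon^{\bullet}\le\frac{w(\Omega)\cdot G\cdot\ln(T)\cdot\sqrt{2D_x}}{\sqrt T}+C_K\epsilon\Big\}\ge 1-2\exp(-\Omega)-\nu_1.$$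
   Context: Setting: $[m]=\{1,\dots,m\}$; $\Delta_k=\{q\in\mathbb{R}_+^k:\sum_r q^{(r)}=1\}$. $X\subseteq\mathbb{R}^d$ is closed and convex. For each $i\in[m]$, $F_r^i:X\to\mathbb{R}$, $r\in[n]$, are convex, $G$-Lipschitz with respect to $\|\cdot\|$ (below), and $|F_r^i(x)|\le M^i$ on $X$; $\mathbf{F}^i(x)=(F_1^i(x),\dots,F_n^i(x))$. $\mathcal{P}^i\subseteq\Delta_n$ is convex and compact, $\mathcal{P}=\mathcal{P}^1\times\cdots\times\mathcal{P}^m$. For given $p_t=(p_t^1,\dots,p_t^m)\in\mathcal{P}$: $f_t^i(x)=(p_t^i)^\top\mathbf{F}^i(x)$ and $\phi_t(x)=\max_{i\in[m]}f_t^i(x)$. Weighted regret: $$\epsilon^{\bullet}=\sum_{t=1}^T\theta_t\phi_t(x_t)-\inf_{x\in X}\sum_{t=1}^T\theta_t\phi_t(x).$$ Mirror descent setup: $\|\cdot\|$ is a norm on the Euclidean space $V_X$ containing $X$, with dual norm $\|\cdot\|_*$; $\psi_x:X\to\mathbb{R}$ is differentiable and 1-strongly convex with respect to $\|\cdot\|$; $B_{\psi_x}(x,y)=\psi_x(x)-\psi_x(y)-\nabla\psi_x(y)^\top(x-y)$; $D_x=\max_{x,y\in X}B_{\psi_x}(x,y)<\infty$. $\epsilon$-SMD update rule: start from $x_1\in X$. At iteration $t$: (1) for each $i\in[m]$ draw i.i.d. indices $s_1,\dots,s_K\in[n]$ from $p_t^i$ (with replacement) and set $\hat f_t^i(x)=\frac1K\sum_{k=1}^K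 F_{s_k}^i(x)$ for $x\in X$; let $\hat i_t\in\operatorname{argmax}_{i\in[m]}\hat f_t^i(x_t)$. (2) Sample an index $I_{x,t}\in[n]$ from the distribution $p_t^{\hat i_t}$ and take $g_{x,t}\in\partial F_{I_{x,t}}^{\hat i_t}(x_t)$. (3) Set $x_{t+1}=\operatorname{argmin}_{x\in X}\{g_{x,t}^\top(x-x_t)+\frac{1}{\alpha_{x,t}}B_{\psi_x}(x,x_t)\}$. All samples are drawn afresh at each iteration.
   Formalization: T ≥ 2 is assumed (for T = 1, ln T = 0 and the claim fails when x_1 is not a minimizer), and the chosen subgradients are assumed to satisfy ‖g_{x,t}‖_* ≤ G, since G-Lipschitz on X alone allows arbitrarily large subgradients at boundary points, for which the claim fails. *)

theory Defs
  imports "HOL-Probability.Probability"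
begin

section \<open>Simplex, norms, convexity\<close>

definition prob_simplex :: "(real ^ 'n) set" where
  "prob_simplex = {q. (\<forall>r. 0 \<le> q $ r) \<and> (\<Sum>r\<in>UNIV. q $ r) = 1}"

definition is_norm :: "('a::real_vector \<Rightarrow> real) \<Rightarrow> bool" where
  "is_norm N \<longleftrightarrow>
     (\<forall>x. 0 \<le> N x) \<and> (\<forall>x. N x = 0 \<longleftrightarrow> x = 0) \<and>
     (\<forall>c x. N (c *\<^sub>R x) = \<bar>c\<bar> * N x) \<and> (\<forall>x y. N (x + y) \<le> N x + N y)"

definition dual_norm :: "('a::real_inner \<Rightarrow> real) \<Rightarrow> 'a \<Rightarrow> real" where
  "dual_norm N g = (SUP h\<in>{h. N h \<le> 1}. g \<bullet> h)"

text \<open>The subdifferential is relative to the domain \<open>X\<close> of \<open>f\<close>: outside of \<open>X\<close> the values of \<open>f\<close>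
  carry no meaning.\<close>

definition subdifferential :: "'a::real_inner set \<Rightarrow> ('a \<Rightarrow> real) \<Rightarrow> 'a \<Rightarrow> 'a set" where
  "subdifferential X f x = {g. \<forall>y\<in>X. f x + g \<bullet> (y - x) \<le> f y}"

definition strongly_convex_on ::
    "'a::real_vector set \<Rightarrow> ('a \<Rightarrow> real) \<Rightarrow> real \<Rightarrow> ('a \<Rightarrow> real) \<Rightarrow> bool" where
  "strongly_convex_on X N \<mu> \<psi> \<longleftrightarrow>
     (\<forall>x\<in>X. \<forall>y\<in>X. \<forall>u\<in>{0..1}.
        \<psi> (u *\<^sub>R x + (1 - u) *\<^sub>R y)
          \<le> u * \<psi> x + (1 - u) * \<psi> y - \<mu> / 2 * u * (1 - u) * (N (x - y))\<^sup>2)"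

text \<open>\<open>d\<psi>\<close> is the gradient of \<open>\<psi>\<close>, as a vector field on \<open>X\<close>.  If \<open>X\<close> is not full-dimensional,
  derivatives within \<open>X\<close> need not be unique, but \<open>bregman\<close> does not depend on the choice
  for points of a convex \<open>X\<close>.\<close>

definition bregman :: "('a::real_inner \<Rightarrow> real) \<Rightarrow> ('a \<Rightarrow> 'a) \<Rightarrow> 'a \<Rightarrow> 'a \<Rightarrow> real" where
  "bregman \<psi> d\<psi> x y = \<psi> x - \<psi> y - d\<psi> y \<bullet> (x - y)"

section \<open>Payoffs and weighted regret\<close>

text \<open>The index sets of constraints and of scenarios are the finite types \<open>'m\<close> and \<open>'n\<close>;
  \<open>F i r\<close> is the \<open>r\<close>-th component function of constraint \<open>i\<close>.\<close>

definition payoff ::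
    "('m \<Rightarrow> 'n \<Rightarrow> 'a \<Rightarrow> real) \<Rightarrow> (nat \<Rightarrow> 'm \<Rightarrow> real ^ 'n) \<Rightarrow> nat \<Rightarrow> 'm \<Rightarrow> 'a \<Rightarrow> real" where
  "payoff F p t i x = p t i \<bullet> (\<chi> r. F i r x)"

definition max_payoff ::
    "('m::finite \<Rightarrow> 'n \<Rightarrow> 'a \<Rightarrow> real) \<Rightarrow> (nat \<Rightarrow> 'm \<Rightarrow> real ^ 'n) \<Rightarrow> nat \<Rightarrow> 'a \<Rightarrow> real" where
  "max_payoff F p t x = (MAX i\<in>UNIV. payoff F p t i x)"

text \<open>\<open>s t i k \<omega>\<close> is the \<open>k\<close>-th index drawn from \<open>p t i\<close> at iteration \<open>t\<close>.\<close>

definition sampled_payoff ::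
    "nat \<Rightarrow> ('m \<Rightarrow> 'n \<Rightarrow> 'a \<Rightarrow> real) \<Rightarrow> (nat \<Rightarrow> 'm \<Rightarrow> nat \<Rightarrow> 'w \<Rightarrow> 'n) \<Rightarrow> nat \<Rightarrow> 'm \<Rightarrow> 'a \<Rightarrow> 'w \<Rightarrow> real"
  where
  "sampled_payoff K F s t i x \<omega> = 1 / real K * (\<Sum>k=1..K. F i (s t i k \<omega>) x)"

definition weighted_regret ::
    "'a set \<Rightarrow> nat \<Rightarrow> (nat \<Rightarrow> real) \<Rightarrow> (nat \<Rightarrow> 'a \<Rightarrow> real) \<Rightarrow> (nat \<Rightarrow> 'a) \<Rightarrow> real" where
  "weighted_regret X T \<theta> \<phi> x =
     (\<Sum>t=1..T. \<theta> t * \<phi> t (x t)) - (INF y\<in>X. \<Sum>t=1..T. \<theta> t * \<phi> t y)"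

section \<open>The stochastic mirror descent update rule\<close>

text \<open>
  \<open>A t\<close> is the information available at the start of iteration \<open>t\<close>, and \<open>B t\<close> the information
  available after its estimation samples \<open>s t\<close> have been drawn and \<open>ihat t\<close> has been selected.
  ``Drawn afresh'' means that, given \<open>A t\<close>, the samples \<open>s t i k\<close> are independent with
  \<open>s t i k\<close> distributed according to \<open>p t i\<close>, and that, given \<open>B t\<close>, the index \<open>J t\<close> (the one
  used for the subgradient step) is distributed according to \<open>p t (ihat t)\<close>.
  Ties in the argmax and the choice of the subgradient are arbitrary (possibly randomized), but
  cannot anticipate later samples.
\<close>

locale eps_smd = prob_space M
  for M :: "'w measure" +
  fixes A B :: "nat \<Rightarrow> 'w measure"
    and X :: "'a::euclidean_space set"
    and F :: "'m::finite \<Rightarrow> 'n::finite \<Rightarrow> 'a \<Rightarrow> real"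
    and p :: "nat \<Rightarrow> 'm \<Rightarrow> real ^ 'n"
    and T K :: nat
    and \<psi> :: "'a \<Rightarrow> real" and d\<psi> :: "'a \<Rightarrow> 'a"
    and \<alpha> :: "nat \<Rightarrow> real"
    and s :: "nat \<Rightarrow> 'm \<Rightarrow> nat \<Rightarrow> 'w \<Rightarrow> 'n"
    and ihat :: "nat \<Rightarrow> 'w \<Rightarrow> 'm"
    and J :: "nat \<Rightarrow> 'w \<Rightarrow> 'n"
    and g :: "nat \<Rightarrow> 'w \<Rightarrow> 'a"
    and x :: "nat \<Rightarrow> 'w \<Rightarrow> 'a"
  assumes subalg: "\<And>t. t \<in> {1..Suc T} \<Longrightarrow> subalgebra M (A t)"
    and subalg': "\<And>t. t \<in> {1..T} \<Longrightarrow> subalgebra (B t) (A t) \<and> subalgebra (A (Suc t)) (B t)"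
    and x_measurable: "\<And>t. t \<in> {1..Suc T} \<Longrightarrow> x t \<in> borel_measurable (A t)"
    and s_measurable: "\<And>t i k. t \<in> {1..T} \<Longrightarrow> k \<in> {1..K} \<Longrightarrow>
          s t i k \<in> measurable (B t) (count_space UNIV)"
    and ihat_measurable: "\<And>t. t \<in> {1..T} \<Longrightarrow> ihat t \<in> measurable (B t) (count_space UNIV)"
    and J_measurable: "\<And>t. t \<in> {1..T} \<Longrightarrow> J t \<in> measurable (A (Suc t)) (count_space UNIV)"
    and g_measurable: "\<And>t. t \<in> {1..T} \<Longrightarrow> g t \<in> borel_measurable (A (Suc t))"
    and init: "\<exists>x\<^sub>1\<in>X. \<forall>\<omega>\<in>space M. x 1 \<omega> = x\<^sub>1"
    and s_law: "\<And>t S \<sigma>. t \<in> {1..T} \<Longrightarrow> S \<in> sets (A t) \<Longrightarrow>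
          prob {\<omega>\<in>S. \<forall>i. \<forall>k\<in>{1..K}. s t i k \<omega> = \<sigma> i k}
            = prob S * (\<Prod>i\<in>UNIV. \<Prod>k=1..K. p t i $ \<sigma> i k)"
    and ihat_argmax: "\<And>t \<omega>. t \<in> {1..T} \<Longrightarrow> \<omega> \<in> space M \<Longrightarrow>
          is_arg_max (\<lambda>i. sampled_payoff K F s t i (x t \<omega>) \<omega>) (\<lambda>i. True) (ihat t \<omega>)"
    and J_law: "\<And>t S i r. t \<in> {1..T} \<Longrightarrow> S \<in> sets (B t) \<Longrightarrow>
          prob {\<omega>\<in>S. ihat t \<omega> = i \<and> J t \<omega> = r} = prob {\<omega>\<in>S. ihat t \<omega> = i} * p t i $ r"
    and g_subgradient: "\<And>t \<omega>. t \<in> {1..T} \<Longrightarrow> \<omega> \<in> space M \<Longrightarrow>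
          g t \<omega> \<in> subdifferential X (F (ihat t \<omega>) (J t \<omega>)) (x t \<omega>)"
    and x_update: "\<And>t \<omega>. t \<in> {1..T} \<Longrightarrow> \<omega> \<in> space M \<Longrightarrow>
          is_arg_min (\<lambda>y. g t \<omega> \<bullet> (y - x t \<omega>) + 1 / \<alpha> t * bregman \<psi> d\<psi> y (x t \<omega>))
            (\<lambda>y. y \<in> X) (x (Suc t) \<omega>)"

end

theory Submission
  imports Defs
begin

text \<open>
  The weighted regret is compared with one fixed minimizer \<open>y\<close> of the weighted objective; it exists
  because a finite Bregman diameter \<open>D\<close> makes the closed set \<open>X\<close> bounded, and it is not random because
  the \<open>p t\<close> are given.  On the event \<open>E\<close>, selecting \<open>ihat t\<close> by the estimates instead of the true
  payoffs loses at most \<open>C\<^sub>K * \<epsilon>\<close> (lemma \<open>max_payoff_gap_le\<close>), so that the loss of iteration \<open>t\<close> is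
  controlled by the difference of the payoffs of \<open>ihat t\<close> at \<open>x t\<close> and at \<open>y\<close>.  This difference is
  the one for the drawn scenario \<open>J t\<close>, at most \<open>g t \<bullet> (x t - y)\<close> by the subgradient inequality, plus
  a noise term that is centred given \<open>B t\<close> and bounded by a multiple of \<open>G * sqrt (2 * D)\<close>.  Working
  with function values rather than with conditional means of the subgradients keeps the noise a
  function of the finitely many values of \<open>ihat t\<close> and \<open>J t\<close> and of the past.

  The inner products with the subgradients are summed by the standard three-point argument of mirror
  descent (\<open>mirror_descent_sum_le\<close>).  The noise is controlled by an exponential moment on \<open>E\<close>: the event
  \<open>E\<close> is an intersection of one event per iteration, which depends only on the estimation samples of
  that iteration and is therefore independent of the past, while \<open>J t\<close> is drawn after these samples.
  Hence restricting to \<open>E\<close> does not disturb the martingale structure, and each iteration contributes a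
  factor from Hoeffding's lemma and the probability of its own event
  (\<open>exp_moment_on_estimation_events\<close>).  Markov's inequality then bounds the bad part of \<open>E\<close>
  by a multiple of the probability of \<open>E\<close> (\<open>regret_tail_on_estimation_events\<close>), from which both
  the conditional and the unconditional claim follow.

  It remains to compare constants.  Apart from the estimation loss, the two arguments bound the regret
  weighted by the step sizes by \<open>D * (1 + H / (2 * \<Omega>) + 2 * sqrt (H * (1 - ln 2 / \<Omega>)))\<close>, where \<open>H\<close> is the
  harmonic sum up to \<open>T\<close>.  The term \<open>ln 2 / \<Omega>\<close> comes from
  spending the whole failure probability \<open>2 * exp (- \<Omega>)\<close> on one tail; without it the claimed rate would not
  follow for \<open>T = 2\<close> and small \<open>\<Omega>\<close> (\<open>regret_rate_constant\<close>).
\<close>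

section \<open>Norms on a Euclidean space\<close>

lemma is_norm_minus: "is_norm N \<Longrightarrow> N (- x) = N x"
  unfolding is_norm_def by (metis abs_minus_cancel abs_one mult_1 scaleR_minus1_left)

lemma is_norm_diff_commute: "is_norm N \<Longrightarrow> N (x - y) = N (y - x)"
  using is_norm_minus[of N "x - y"] by simp

text \<open>
  Expanding a vector in the standard basis bounds any norm by a multiple of the Euclidean one.
\<close>

lemma is_norm_le_norm:
  fixes N :: "'a::euclidean_space \<Rightarrow> real"
  assumes N: "is_norm N"
  shows "\<exists>C>0. \<forall>x. N x \<le> C * norm x"
proof (intro exI conjI allI)
  have nonneg: "\<And>x. 0 \<le> N x" and scale: "\<And>c x. N (c *\<^sub>R x) = \<bar>c\<bar> * N x"
    and tri: "\<And>x y. N (x + y) \<le> N x + N y" and zero: "N 0 = 0"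
    using N by (auto simp: is_norm_def)
  have sum: "N (\<Sum>b\<in>S. f b) \<le> (\<Sum>b\<in>S. N (f b))" if "finite S" for S and f :: "'a \<Rightarrow> 'a"
    using that
  proof induction
    case (insert b S)
    then show ?case using tri[of "f b" "\<Sum>b\<in>S. f b"] by simp
  qed (simp add: zero)
  show "(\<Sum>b\<in>Basis. N b) + 1 > 0" using nonneg by (simp add: add_nonneg_pos sum_nonneg)
  fix x :: 'a
  have "N x = N (\<Sum>b\<in>Basis. (x \<bullet> b) *\<^sub>R b)" by (simp add: euclidean_representation)
  also have "\<dots> \<le> (\<Sum>b\<in>Basis. \<bar>x \<bullet> b\<bar> * N b)" using sum[of Basis "\<lambda>b. (x \<bullet> b) *\<^sub>R b"] by (simp add: scale)
  also have "\<dots> \<le> (\<Sum>b\<in>Basis. norm x * N b)"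
    using nonneg by (intro sum_mono mult_right_mono Basis_le_norm) auto
  also have "\<dots> = (\<Sum>b\<in>Basis. N b) * norm x"
    by (simp add: sum_distrib_left mult.commute)
  also have "\<dots> \<le> ((\<Sum>b\<in>Basis. N b) + 1) * norm x"
    by (simp add: distrib_right)
  finally show "N x \<le> ((\<Sum>b\<in>Basis. N b) + 1) * norm x" .
qed

lemma is_norm_continuous:
  fixes N :: "'a::euclidean_space \<Rightarrow> real"
  assumes N: "is_norm N"
  shows "continuous_on S N"
proof -
  obtain C where C: "C > 0" "\<And>x. N x \<le> C * norm x" using is_norm_le_norm[OF N] by blast
  have tri: "\<And>x y. N (x + y) \<le> N x + N y" using N by (auto simp: is_norm_def)
  have "dist (N x) (N y) \<le> C * dist x y" for x y
    using tri[of y "x - y"] tri[of x "y - x"] is_norm_diff_commute[OF N, of x y] C(2)[of "x - y"]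
    by (simp add: dist_real_def dist_norm abs_le_iff)
  then show ?thesis
    using C(1) by (intro lipschitz_on_continuous_on[of C] lipschitz_onI) auto
qed

text \<open>
  The other half of the equivalence of norms in finite dimension: the norm attains a positive minimum on the compact Euclidean unit sphere.
\<close>

lemma norm_le_is_norm:
  fixes N :: "'a::euclidean_space \<Rightarrow> real"
  assumes N: "is_norm N"
  shows "\<exists>C>0. \<forall>x. norm x \<le> C * N x"
proof -
  have "sphere 0 1 \<noteq> ({} :: 'a set)" using vector_choose_size[of 1] by force
  then obtain u :: 'a where u: "u \<in> sphere 0 1" "\<And>y. y \<in> sphere 0 1 \<Longrightarrow> N u \<le> N y"
    using continuous_attains_inf[OF compact_sphere _ is_norm_continuous[OF N], of 0 1] by metis
  have "0 < N u"
    using u(1) N unfolding is_norm_def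
    by (metis less_eq_real_def mem_sphere_0 norm_zero zero_neq_one)
  show ?thesis
  proof (intro exI conjI allI)
    show "1 / N u > 0" using \<open>0 < N u\<close> by simp
    fix x :: 'a
    show "norm x \<le> 1 / N u * N x"
    proof (cases "x = 0")
      case True
      then show ?thesis using N \<open>0 < N u\<close> by (simp add: is_norm_def)
    next
      case False
      then have "N u \<le> N ((1 / norm x) *\<^sub>R x)" by (intro u(2)) simp
      also have "\<dots> = N x / norm x" using N by (simp add: is_norm_def)
      finally show ?thesis using False \<open>0 < N u\<close> by (simp add: field_simps)
    qed
  qed
qed

text \<open>
  Equivalence of norms enters through the supremum that defines the dual norm, which is only meaningful
  when its range is bounded above.
\<close>

lemma inner_le_dual_norm:
  fixes N :: "'a::euclidean_space \<Rightarrow> real"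
  assumes N: "is_norm N"
  shows "g \<bullet> h \<le> dual_norm N g * N h"
proof (cases "h = 0")
  case True
  have "N 0 = 0" using N by (auto simp: is_norm_def)
  then show ?thesis using True by simp
next
  case False
  obtain C where C: "C > 0" "\<And>x. norm x \<le> C * N x" using norm_le_is_norm[OF N] by blast
  have pos: "0 < N h" using False N by (metis is_norm_def less_eq_real_def)
  have "g \<bullet> y \<le> norm g * C" if "N y \<le> 1" for y
  proof -
    have "norm y \<le> C * 1"
      using C(2)[of y] mult_left_mono[OF that less_imp_le[OF C(1)]] by linarith
    then show ?thesis
      using norm_cauchy_schwarz[of g y] mult_left_mono[of "norm y" C "norm g"] by simp
  qed
  then have "bdd_above ((\<lambda>y. g \<bullet> y) ` {y. N y \<le> 1})" by (auto simp: bdd_above_def)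
  moreover have "N ((1 / N h) *\<^sub>R h) \<le> 1" using N pos by (simp add: is_norm_def)
  ultimately have "g \<bullet> ((1 / N h) *\<^sub>R h) \<le> dual_norm N g"
    unfolding dual_norm_def by (intro cSUP_upper) auto
  then show ?thesis using pos by (simp add: field_simps)
qed

lemma continuous_on_is_norm_lipschitz:
  fixes N :: "'a::euclidean_space \<Rightarrow> real" and f :: "'a \<Rightarrow> real"
  assumes N: "is_norm N" and G: "G \<ge> 0"
    and f: "\<And>y z. y \<in> X \<Longrightarrow> z \<in> X \<Longrightarrow> \<bar>f y - f z\<bar> \<le> G * N (y - z)"
  shows "continuous_on X f"
proof -
  obtain C where C: "C > 0" "\<And>x. N x \<le> C * norm x" using is_norm_le_norm[OF N] by blast
  have "dist (f y) (f z) \<le> G * C * dist y z" if "y \<in> X" "z \<in> X" for y z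
    using f[OF that] mult_left_mono[OF C(2)[of "y - z"] G]
    by (simp add: dist_real_def dist_norm mult.assoc)
  then show ?thesis
    using C(1) G by (intro lipschitz_on_continuous_on[of "G * C"] lipschitz_onI) auto
qed

section \<open>Mirror descent\<close>

text \<open>
  Differentiability is only available relative to \<open>X\<close>, but a point of the convex set \<open>X\<close> can always be
  left along a segment inside \<open>X\<close>.  This first-order condition for a minimum at the start of the segment
  yields both the gradient inequality for strongly convex functions and the optimality condition of a
  mirror step; the function \<open>k\<close> collects the terms that are explicit in the segment parameter.
\<close>

lemma segment_derivative_nonneg:
  fixes f :: "'a::real_normed_vector \<Rightarrow> real"
  assumes X: "convex X" "x \<in> X" "y \<in> X"
    and f: "(f has_derivative f') (at x within X)"
    and k: "(k has_real_derivative l) (at 0 within {0..1})"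
    and le: "\<And>u. u \<in> {0..1} \<Longrightarrow> f x + k 0 \<le> f (x + u *\<^sub>R (y - x)) + k u"
  shows "0 \<le> f' (y - x) + l"
proof (rule ccontr)
  assume neg: "\<not> 0 \<le> f' (y - x) + l"
  define \<gamma> where "\<gamma> u = x + u *\<^sub>R (y - x)" for u :: real
  have \<gamma>X: "\<gamma> ` {0..1} \<subseteq> X"
  proof (clarify)
    fix u :: real assume "u \<in> {0..1}"
    then have "(1 - u) *\<^sub>R x + u *\<^sub>R y \<in> X" using X by (intro convexD) auto
    then show "\<gamma> u \<in> X" by (simp add: \<gamma>_def algebra_simps)
  qed
  have "(\<gamma> has_derivative (\<lambda>u. u *\<^sub>R (y - x))) (at 0 within {0..1})"
    unfolding \<gamma>_def by (auto intro!: derivative_eq_intros)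
  moreover have "(f has_derivative f') (at (\<gamma> 0) within \<gamma> ` {0..1})"
    using has_derivative_subset[OF f \<gamma>X] by (simp add: \<gamma>_def)
  ultimately have "((\<lambda>u. f (\<gamma> u)) has_derivative (\<lambda>u. f' (u *\<^sub>R (y - x)))) (at 0 within {0..1})"
    by (rule has_derivative_in_compose)
  moreover have "(\<lambda>u. f' (u *\<^sub>R (y - x))) = (*) (f' (y - x))"
    using has_derivative_linear[OF f] by (simp add: fun_eq_iff linear_scale)
  ultimately have "((\<lambda>u. f (\<gamma> u)) has_real_derivative f' (y - x)) (at 0 within {0..1})"
    by (simp add: has_field_derivative_def)
  from DERIV_add[OF this k]
  have "((\<lambda>u. f (\<gamma> u) + k u) has_real_derivative f' (y - x) + l) (at 0 within {0..1})" .
  from has_real_derivative_neg_dec_right[OF this] neg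
  obtain d where d: "d > 0"
    "\<And>u. 0 < u \<Longrightarrow> u \<in> {0..1} \<Longrightarrow> u < d \<Longrightarrow> f (\<gamma> u) + k u < f (\<gamma> 0) + k 0"
    by auto
  define u where "u = min (d / 2) 1"
  have "0 < u" "u \<in> {0..1}" "u < d" using d(1) by (auto simp: u_def)
  then show False using d(2)[of u] le[of u] by (simp add: \<gamma>_def)
qed

text \<open>
  Strong convexity along the segment from \<open>x\<close> to \<open>y\<close> says that the chord minus the quadratic gain
  minus \<open>\<psi>\<close> is minimal, namely zero, at \<open>x\<close>; its derivative there is the claim.
\<close>

lemma bregman_ge:
  assumes N: "is_norm N" and X: "convex X" "x \<in> X" "y \<in> X"
    and \<psi>: "(\<psi> has_derivative (\<lambda>h. d\<psi> x \<bullet> h)) (at x within X)"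
    and sc: "strongly_convex_on X N 1 \<psi>"
  shows "(N (y - x))\<^sup>2 / 2 \<le> bregman \<psi> d\<psi> y x"
proof -
  define c where "c = (N (y - x))\<^sup>2 / 2"
  define k where "k u = u * \<psi> y + (1 - u) * \<psi> x - u * (1 - u) * c" for u :: real
  have "0 \<le> - (d\<psi> x \<bullet> (y - x)) + (\<psi> y - \<psi> x - c)"
  proof (rule segment_derivative_nonneg[OF X, where f = "\<lambda>z. - \<psi> z" and f' = "\<lambda>h. - (d\<psi> x \<bullet> h)" and k = k])
    show "((\<lambda>z. - \<psi> z) has_derivative (\<lambda>h. - (d\<psi> x \<bullet> h))) (at x within X)"
      using \<psi> by (rule has_derivative_minus)
    show "(k has_real_derivative \<psi> y - \<psi> x - c) (at 0 within {0..1})"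
      unfolding k_def by (auto intro!: derivative_eq_intros)
    fix u :: real assume u: "u \<in> {0..1}"
    have "\<psi> (u *\<^sub>R y + (1 - u) *\<^sub>R x) \<le> k u"
      using sc X u unfolding strongly_convex_on_def k_def c_def by force
    moreover have "x + u *\<^sub>R (y - x) = u *\<^sub>R y + (1 - u) *\<^sub>R x" by (simp add: algebra_simps)
    ultimately show "- \<psi> x + k 0 \<le> - \<psi> (x + u *\<^sub>R (y - x)) + k u"
      by (simp add: k_def)
  qed
  then show ?thesis by (simp add: bregman_def c_def)
qed

text \<open>
  The three-point identity for Bregman divergences turns the optimality of \<open>x'\<close> into the difference of
  the divergences from \<open>y\<close>, less the divergence from \<open>x\<close> to \<open>x'\<close>.  By strong convexity the latter
  absorbs the square of the step length that arises when \<open>g \<bullet> (x - x')\<close> is split by the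
  arithmetic-geometric mean inequality.
\<close>

lemma mirror_step:
  fixes N :: "'a::euclidean_space \<Rightarrow> real"
  assumes N: "is_norm N" and X: "convex X" "x \<in> X" "y \<in> X"
    and \<psi>: "\<And>z. z \<in> X \<Longrightarrow> (\<psi> has_derivative (\<lambda>h. d\<psi> z \<bullet> h)) (at z within X)"
    and sc: "strongly_convex_on X N 1 \<psi>"
    and a: "a > 0" and g: "dual_norm N g \<le> G"
    and x': "is_arg_min (\<lambda>z. g \<bullet> (z - x) + 1 / a * bregman \<psi> d\<psi> z x) (\<lambda>z. z \<in> X) x'"
  shows "a * (g \<bullet> (x - y)) \<le> bregman \<psi> d\<psi> y x - bregman \<psi> d\<psi> y x' + a\<^sup>2 * G\<^sup>2 / 2"
proof -
  have x'X: "x' \<in> X" and min: "\<And>z. z \<in> X \<Longrightarrow>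
      g \<bullet> (x' - x) + 1 / a * bregman \<psi> d\<psi> x' x \<le> g \<bullet> (z - x) + 1 / a * bregman \<psi> d\<psi> z x"
    using x' by (auto simp: is_arg_min_def not_less)
  define k where "k u = u * ((a *\<^sub>R g - d\<psi> x) \<bullet> (y - x'))" for u
  have opt: "0 \<le> d\<psi> x' \<bullet> (y - x') + (a *\<^sub>R g - d\<psi> x) \<bullet> (y - x')"
  proof (rule segment_derivative_nonneg[OF X(1) x'X X(3) \<psi>[OF x'X], where k = k])
    show "(k has_real_derivative (a *\<^sub>R g - d\<psi> x) \<bullet> (y - x')) (at 0 within {0..1})"
      unfolding k_def by (auto intro!: derivative_eq_intros)
    fix u :: real assume u: "u \<in> {0..1}"
    have "(1 - u) *\<^sub>R x' + u *\<^sub>R y \<in> X" using X x'X u by (intro convexD) auto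
    then have "x' + u *\<^sub>R (y - x') \<in> X" by (simp add: algebra_simps)
    from mult_left_mono[OF min[OF this], of a] a
    have "a * (g \<bullet> (x' - x)) + bregman \<psi> d\<psi> x' x
        \<le> a * (g \<bullet> (x' + u *\<^sub>R (y - x') - x)) + bregman \<psi> d\<psi> (x' + u *\<^sub>R (y - x')) x"
      by (simp add: distrib_left)
    then show "\<psi> x' + k 0 \<le> \<psi> (x' + u *\<^sub>R (y - x')) + k u"
      by (simp add: k_def bregman_def inner_diff_left inner_diff_right inner_add_right algebra_simps)
  qed
  have quad: "(N (x' - x))\<^sup>2 / 2 \<le> bregman \<psi> d\<psi> x' x"
    by (rule bregman_ge[OF N X(1,2) x'X _ sc]) (rule \<psi>[OF X(2)])
  have "g \<bullet> (x - x') \<le> G * N (x' - x)"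
    using inner_le_dual_norm[OF N, of g "x - x'"] g N is_norm_diff_commute[OF N, of x x']
    by (smt (verit) is_norm_def mult_right_mono)
  then have "a * (g \<bullet> (x - x')) \<le> a * G * N (x' - x)" using a by (simp add: mult.assoc)
  also have "\<dots> \<le> a\<^sup>2 * G\<^sup>2 / 2 + (N (x' - x))\<^sup>2 / 2"
    using sum_squares_bound[of "a * G" "N (x' - x)"] by (simp add: power_mult_distrib)
  finally have "a * (g \<bullet> (x - x')) \<le> a\<^sup>2 * G\<^sup>2 / 2 + bregman \<psi> d\<psi> x' x" using quad by linarith
  \<comment> \<open>the optimality condition, rewritten by the three-point identity\<close>
  moreover have "a * (g \<bullet> (x' - y)) \<le> bregman \<psi> d\<psi> y x - bregman \<psi> d\<psi> y x' - bregman \<psi> d\<psi> x' x"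
    using opt by (simp add: bregman_def inner_diff_left inner_diff_right algebra_simps)
  moreover have "a * (g \<bullet> (x - y)) = a * (g \<bullet> (x - x')) + a * (g \<bullet> (x' - y))"
    by (simp add: inner_diff_right algebra_simps)
  ultimately show ?thesis by linarith
qed

lemma mirror_descent_sum_le:
  fixes N :: "'a::euclidean_space \<Rightarrow> real"
  assumes N: "is_norm N" and X: "convex X"
    and \<psi>: "\<And>z. z \<in> X \<Longrightarrow> (\<psi> has_derivative (\<lambda>h. d\<psi> z \<bullet> h)) (at z within X)"
    and sc: "strongly_convex_on X N 1 \<psi>"
    and D: "\<And>y z. y \<in> X \<Longrightarrow> z \<in> X \<Longrightarrow> bregman \<psi> d\<psi> y z \<le> D"
    and x: "\<And>t. t \<in> {1..Suc T} \<Longrightarrow> x t \<in> X" and y: "y \<in> X"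
    and \<alpha>: "\<And>t. t \<in> {1..T} \<Longrightarrow> \<alpha> t > 0" and g: "\<And>t. t \<in> {1..T} \<Longrightarrow> dual_norm N (g t) \<le> G"
    and step: "\<And>t. t \<in> {1..T} \<Longrightarrow>
      is_arg_min (\<lambda>z. g t \<bullet> (z - x t) + 1 / \<alpha> t * bregman \<psi> d\<psi> z (x t)) (\<lambda>z. z \<in> X) (x (Suc t))"
  shows "(\<Sum>t=1..T. \<alpha> t * (g t \<bullet> (x t - y))) \<le> D + G\<^sup>2 / 2 * (\<Sum>t=1..T. (\<alpha> t)\<^sup>2)"
proof -
  define V where "V t = bregman \<psi> d\<psi> y (x t)" for t
  have "(\<Sum>t=1..T. \<alpha> t * (g t \<bullet> (x t - y))) \<le> (\<Sum>t=1..T. - (V (Suc t) - V t) + G\<^sup>2 / 2 * (\<alpha> t)\<^sup>2)"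
  proof (rule sum_mono)
    fix t assume t: "t \<in> {1..T}"
    have "x t \<in> X" using t by (intro x) auto
    from mirror_step[OF N X this y \<psi> sc \<alpha>[OF t] g[OF t] step[OF t]]
    show "\<alpha> t * (g t \<bullet> (x t - y)) \<le> - (V (Suc t) - V t) + G\<^sup>2 / 2 * (\<alpha> t)\<^sup>2"
      by (simp add: V_def mult.commute)
  qed
  also have "\<dots> = - (V (Suc T) - V 1) + G\<^sup>2 / 2 * (\<Sum>t=1..T. (\<alpha> t)\<^sup>2)"
  proof -
    have "(\<Sum>t=1..T. V (Suc t) - V t) = V (Suc T) - V 1" by (rule sum_Suc_diff) simp
    then show ?thesis by (simp only: sum.distrib sum_negf sum_distrib_left)
  qed
  also have "V 1 \<le> D" unfolding V_def by (intro D y x) auto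
  moreover have "0 \<le> V (Suc T)"
    unfolding V_def using bregman_ge[OF N X x[of "Suc T"] y _ sc] \<psi>[OF x[of "Suc T"]]
    by (smt (verit, best) atLeastAtMost_iff divide_nonneg_nonneg le_add1 le_refl plus_1_eq_Suc zero_le_power2)
  ultimately show ?thesis by linarith
qed

section \<open>Maxima of expected payoffs\<close>

lemma payoff_eq_sum: "payoff F p t i y = (\<Sum>r\<in>UNIV. p t i $ r * F i r y)"
  by (simp add: payoff_def inner_vec_def)

lemma payoff_diff_le:
  assumes p: "p t i \<in> prob_simplex" and F: "\<And>r. \<bar>F i r y - F i r z\<bar> \<le> L"
  shows "\<bar>payoff F p t i y - payoff F p t i z\<bar> \<le> L"
proof -
  have p: "\<And>r. 0 \<le> p t i $ r" "(\<Sum>r\<in>UNIV. p t i $ r) = 1"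
    using p by (auto simp: prob_simplex_def)
  have "\<bar>payoff F p t i y - payoff F p t i z\<bar> = \<bar>\<Sum>r\<in>UNIV. p t i $ r * (F i r y - F i r z)\<bar>"
    by (simp add: payoff_eq_sum right_diff_distrib sum_subtractf)
  also have "\<dots> \<le> (\<Sum>r\<in>UNIV. \<bar>p t i $ r * (F i r y - F i r z)\<bar>)"
    by (rule sum_abs)
  also have "\<dots> \<le> (\<Sum>r\<in>UNIV. p t i $ r * L)"
    using p(1) F by (intro sum_mono) (simp add: abs_mult mult_left_mono)
  also have "\<dots> = L" by (simp add: p(2) flip: sum_distrib_right)
  finally show ?thesis .
qed

lemma payoff_le_max: "payoff F p t i y \<le> max_payoff F p t y"
  by (simp add: max_payoff_def)

lemma max_payoff_attained:
  obtains i where "max_payoff F p t y = payoff F p t i y"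
proof -
  have "max_payoff F p t y \<in> range (\<lambda>i. payoff F p t i y)"
    unfolding max_payoff_def by (rule Max_in) auto
  then show ?thesis using that by blast
qed

lemma max_payoff_diff_le:
  assumes "\<And>i. \<bar>payoff F p t i y - payoff F p t i z\<bar> \<le> L"
  shows "\<bar>max_payoff F p t y - max_payoff F p t z\<bar> \<le> L"
proof -
  have "max_payoff F p t a - max_payoff F p t b \<le> L"
    if "\<And>i. \<bar>payoff F p t i a - payoff F p t i b\<bar> \<le> L" for a b
  proof -
    obtain i where "max_payoff F p t a = payoff F p t i a" by (rule max_payoff_attained)
    then show ?thesis using that[of i] payoff_le_max[of F p t i b] by linarith
  qed
  from this[of y z] this[of z y] assms show ?thesis by (simp add: abs_le_iff abs_minus_commute)
qed

text \<open>
  The estimates are used twice, for the true maximizer and for the selected index, whence the factor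
  \<open>2\<close>.  At the comparison point \<open>z\<close> the maximum is simply bounded below by the payoff of the selected index.
\<close>

lemma max_payoff_gap_le:
  assumes est: "\<And>i. \<bar>f i - payoff F p t i y\<bar> \<le> \<delta>"
    and j: "is_arg_max f (\<lambda>i. True) j"
  shows "max_payoff F p t y - max_payoff F p t z \<le> 2 * \<delta> + (payoff F p t j y - payoff F p t j z)"
proof -
  obtain i where i: "max_payoff F p t y = payoff F p t i y" by (rule max_payoff_attained)
  have "f i \<le> f j" using j by (simp add: is_arg_max_def not_less)
  then show ?thesis
    using est[of i] est[of j] i payoff_le_max[of F p t j z] by (simp add: abs_le_iff)
qed

lemma continuous_on_max_payoff:
  fixes N :: "'a::euclidean_space \<Rightarrow> real"
  assumes N: "is_norm N" and G: "G > 0"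
    and F: "\<And>i r y z. y \<in> X \<Longrightarrow> z \<in> X \<Longrightarrow> \<bar>F i r y - F i r z\<bar> \<le> G * N (y - z)"
    and p: "\<And>i. p t i \<in> prob_simplex"
  shows "continuous_on X (max_payoff F p t)"
proof (rule continuous_on_is_norm_lipschitz[OF N less_imp_le[OF G]])
  fix y z assume "y \<in> X" "z \<in> X"
  then show "\<bar>max_payoff F p t y - max_payoff F p t z\<bar> \<le> G * N (y - z)"
    using p F by (intro max_payoff_diff_le payoff_diff_le)
qed

section \<open>Conditional laws and exponential moments\<close>

text \<open>
  The sampling assumptions prescribe probabilities of events; exponential moments need the same
  statement for weights \<open>W\<close> known to the sub-\<open>\<sigma>\<close>-algebra.  For \<open>R'\<close> the whole space, the hypothesis says that \<open>R\<close> is independent of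
  \<open>\<F>\<close>; in general it gives \<open>R\<close> a constant conditional probability relative to \<open>R'\<close>.  The proof
  identifies the two restricted measures on \<open>\<F>\<close>.
\<close>

lemma nn_integral_conditional_law:
  assumes M: "prob_space M" and sub: "subalgebra M \<F>"
    and R: "R \<in> sets M" and R': "R' \<in> sets M" and c: "0 \<le> c"
    and law: "\<And>S. S \<in> sets \<F> \<Longrightarrow> measure M (S \<inter> R) = c * measure M (S \<inter> R')"
    and W: "W \<in> borel_measurable \<F>"
  shows "(\<integral>\<^sup>+\<omega>. W \<omega> * indicator R \<omega> \<partial>M) = ennreal c * (\<integral>\<^sup>+\<omega>. W \<omega> * indicator R' \<omega> \<partial>M)"
proof -
  interpret prob_space M by (rule M)
  have *: "(\<integral>\<^sup>+\<omega>. W \<omega> * indicator Q \<omega> \<partial>M) = (\<integral>\<^sup>+\<omega>. W \<omega> \<partial>restr_to_subalg (density M (indicator Q)) \<F>)"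
    if Q: "Q \<in> sets M" for Q
  proof -
    have "subalgebra (density M (indicator Q)) \<F>"
      using sub by (simp add: subalgebra_def)
    then have "(\<integral>\<^sup>+\<omega>. W \<omega> \<partial>restr_to_subalg (density M (indicator Q)) \<F>)
        = (\<integral>\<^sup>+\<omega>. W \<omega> \<partial>density M (indicator Q))"
      using W by (rule nn_integral_subalgebra2)
    also have "\<dots> = (\<integral>\<^sup>+\<omega>. indicator Q \<omega> * W \<omega> \<partial>M)"
      using Q measurable_from_subalg[OF sub W] by (intro nn_integral_density) auto
    finally show ?thesis by (simp add: mult.commute)
  qed
  have restr: "emeasure (restr_to_subalg (density M (indicator Q)) \<F>) S = emeasure M (S \<inter> Q)"
    if "Q \<in> sets M" "S \<in> sets \<F>" for Q S
  proof -
    have "S \<in> sets M" using that sub by (auto simp: subalgebra_def)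
    then show ?thesis
      using that sub
      by (subst emeasure_restr_to_subalg)
         (auto simp: subalgebra_def emeasure_density Int_commute
            nn_integral_indicator indicator_inter_arith[symmetric])
  qed
  have sets: "sets (restr_to_subalg (density M (indicator Q)) \<F>) = sets \<F>" for Q
    by (rule sets_restr_to_subalg) (use sub in \<open>simp add: subalgebra_def\<close>)
  have "restr_to_subalg (density M (indicator R)) \<F>
      = scale_measure (ennreal c) (restr_to_subalg (density M (indicator R')) \<F>)"
  proof (rule measure_eqI)
    fix S assume "S \<in> sets (restr_to_subalg (density M (indicator R)) \<F>)"
    then have "S \<in> sets \<F>" by (simp add: sets)
    then show "emeasure (restr_to_subalg (density M (indicator R)) \<F>) S
      = emeasure (scale_measure (ennreal c) (restr_to_subalg (density M (indicator R')) \<F>)) S"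
      using R R' c law by (simp add: restr emeasure_eq_measure ennreal_mult)
  qed (simp add: sets)
  moreover have "W \<in> borel_measurable (restr_to_subalg (density M (indicator R')) \<F>)"
    using W measurable_cong_sets[OF sets refl] by blast
  ultimately show ?thesis
    using R R' by (simp add: * nn_integral_scale_measure)
qed

text \<open>
  Hoeffding's lemma for a variable on the finite scenario set with law \<open>q\<close>, whose values lie in an interval of length \<open>2 * R\<close>.
\<close>

lemma hoeffding_finite_exp:
  fixes q :: "real ^ 'n::finite" and a :: "'n \<Rightarrow> real"
  assumes q: "q \<in> prob_simplex" and a: "\<And>r. \<bar>a r\<bar> \<le> R" and l: "l > 0"
  shows "(\<Sum>r\<in>UNIV. q $ r * exp (l * ((\<Sum>r\<in>UNIV. q $ r * a r) - a r))) \<le> exp (l\<^sup>2 * R\<^sup>2 / 2)"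
proof -
  define \<mu> where "\<mu> = (\<Sum>r\<in>UNIV. q $ r * a r)"
  have q0: "\<And>r. 0 \<le> q $ r" and q1: "(\<Sum>r\<in>UNIV. q $ r) = 1"
    using q by (auto simp: prob_simplex_def)
  define Q where "Q = embed_pmf (($) q)"
  have pmf: "pmf Q r = q $ r" for r
    unfolding Q_def using q0 q1
    by (subst pmf_embed_pmf) (auto simp: nn_integral_count_space_finite sum_ennreal)
  have E: "(\<integral>r. f r \<partial>Q) = (\<Sum>r\<in>UNIV. q $ r * f r)" for f :: "'n \<Rightarrow> real"
    by (subst integral_measure_pmf_real[where A = UNIV]) (auto simp: pmf mult.commute)
  interpret H: interval_bounded_random_variable "measure_pmf Q" "\<lambda>r. \<mu> - a r" "\<mu> - R" "\<mu> + R"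
  proof unfold_locales
    have "\<mu> - a r \<in> {\<mu> - R..\<mu> + R}" for r using a[of r] by auto
    then show "AE r in measure_pmf Q. \<mu> - a r \<in> {\<mu> - R..\<mu> + R}" by (intro AE_pmfI)
  qed simp
  have "(\<integral>r. \<mu> - a r \<partial>Q) = 0"
    by (simp add: E right_diff_distrib sum_subtractf q1 \<mu>_def flip: sum_distrib_right)
  from H.Hoeffdings_lemma_nn_integral_0[OF l this]
  have "(\<integral>\<^sup>+r. exp (l * (\<mu> - a r)) \<partial>Q) \<le> ennreal (exp (l\<^sup>2 * (2 * R)\<^sup>2 / 8))"
    by simp
  moreover have "(\<integral>\<^sup>+r. exp (l * (\<mu> - a r)) \<partial>Q) = ennreal (\<integral>r. exp (l * (\<mu> - a r)) \<partial>Q)"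
    by (intro nn_integral_eq_integral integrable_measure_pmf_finite) auto
  ultimately show ?thesis
    by (simp add: E \<mu>_def power_mult_distrib mult.commute)
qed

section \<open>Independence of the estimation samples from the past\<close>

context eps_smd
begin

lemma filtration:
  assumes t: "t \<in> {1..T}"
  shows "subalgebra M (A t)" "subalgebra (B t) (A t)" "subalgebra M (B t)"
    "subalgebra (A (Suc t)) (B t)" "subalgebra M (A (Suc t))"
proof -
  show 1: "subalgebra M (A t)" "subalgebra M (A (Suc t))" using t by (auto intro: subalg)
  show 2: "subalgebra (B t) (A t)" "subalgebra (A (Suc t)) (B t)" using subalg'[OF t] by blast+
  show "subalgebra M (B t)" using 2(2) 1(2) unfolding subalgebra_def by (metis subset_trans)
qed

text \<open>
  All estimation samples of one iteration as a single value.  The restriction to \<open>{1..K}\<close> makes the range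
  finite, so that events about the samples are finite unions of the atoms whose probabilities are known.
\<close>

definition estimation_draw :: "nat \<Rightarrow> 'w \<Rightarrow> 'm \<Rightarrow> nat \<Rightarrow> 'n" where
  "estimation_draw t \<omega> = (\<lambda>i. restrict (\<lambda>k. s t i k \<omega>) {1..K})"

definition estimation_draws :: "('m \<Rightarrow> nat \<Rightarrow> 'n) set" where
  "estimation_draws = PiE UNIV (\<lambda>_. PiE {1..K} (\<lambda>_. UNIV))"

lemma finite_estimation_draws: "finite estimation_draws"
  unfolding estimation_draws_def by (intro finite_PiE) auto

lemma estimation_draw_eq_iff:
  assumes "\<sigma> \<in> estimation_draws"
  shows "estimation_draw t \<omega> = \<sigma> \<longleftrightarrow> (\<forall>i. \<forall>k\<in>{1..K}. s t i k \<omega> = \<sigma> i k)"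
proof -
  have "\<sigma> i \<in> extensional {1..K}" for i
    using assms by (auto simp: estimation_draws_def PiE_def Pi_def)
  then show ?thesis
    by (force simp: estimation_draw_def fun_eq_iff extensional_def)
qed

lemma estimation_draw_range:
  "estimation_draw t \<omega> \<in> estimation_draws"
  by (auto simp: estimation_draw_def estimation_draws_def)

lemma estimation_event_measurable:
  assumes t: "t \<in> {1..T}"
  shows "{\<omega> \<in> space M. Q (estimation_draw t \<omega>)} \<in> sets (B t)"
proof -
  have sp: "space (B t) = space M"
    using subalg[of t] subalg'[of t] t by (simp add: subalgebra_def)
  have "{\<omega> \<in> space M. Q (estimation_draw t \<omega>)}
      = (\<Union>\<sigma>\<in>{\<sigma>\<in>estimation_draws. Q \<sigma>}. {\<omega> \<in> space (B t). estimation_draw t \<omega> = \<sigma>})"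
    using estimation_draw_range by (auto simp: sp)
  moreover have "{\<omega> \<in> space (B t). estimation_draw t \<omega> = \<sigma>} \<in> sets (B t)" if \<sigma>: "\<sigma> \<in> estimation_draws" for \<sigma>
  proof -
    have [measurable]: "{\<omega> \<in> space (B t). s t i k \<omega> = \<sigma> i k} \<in> sets (B t)" if "k \<in> {1..K}" for i k
      using s_measurable[OF t that] by measurable
    show ?thesis
      unfolding estimation_draw_eq_iff[OF \<sigma>]
      by (intro sets.sets_Collect_countable_All sets.sets_Collect_finite_All) auto
  qed
  moreover have "finite {\<sigma>\<in>estimation_draws. Q \<sigma>}" using finite_estimation_draws by simp
  ultimately show ?thesis by auto
qed

lemma estimation_atom_indep:
  assumes t: "t \<in> {1..T}" and S: "S \<in> sets (A t)"
    and \<sigma>: "\<sigma> \<in> estimation_draws"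
  shows "prob (S \<inter> {\<omega> \<in> space M. estimation_draw t \<omega> = \<sigma>})
    = prob S * (\<Prod>i\<in>UNIV. \<Prod>k=1..K. p t i $ \<sigma> i k)"
proof -
  have "S \<subseteq> space M"
    using S filtration(1)[OF t] sets.sets_into_space unfolding subalgebra_def by blast
  then have "S \<inter> {\<omega> \<in> space M. estimation_draw t \<omega> = \<sigma>}
      = {\<omega>\<in>S. \<forall>i. \<forall>k\<in>{1..K}. s t i k \<omega> = \<sigma> i k}"
    unfolding estimation_draw_eq_iff[OF \<sigma>] by blast
  then show ?thesis by (simp only: s_law[OF t S])
qed

lemma estimation_event_prob:
  assumes t: "t \<in> {1..T}" and S: "S \<in> sets (A t)"
  shows "prob (S \<inter> {\<omega> \<in> space M. Q (estimation_draw t \<omega>)}) = prob S *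
    (\<Sum>\<sigma> | \<sigma> \<in> estimation_draws \<and> Q \<sigma>. \<Prod>i\<in>UNIV. \<Prod>k=1..K. p t i $ \<sigma> i k)"
proof -
  let ?Q = "{\<sigma>. \<sigma> \<in> estimation_draws \<and> Q \<sigma>}"
  define D where "D \<sigma> = S \<inter> {\<omega> \<in> space M. estimation_draw t \<omega> = \<sigma>}" for \<sigma>
  have SM: "S \<in> events" using S filtration(1)[OF t] unfolding subalgebra_def by blast
  have D: "D \<sigma> \<in> events" for \<sigma>
    using SM estimation_event_measurable[OF t, of "\<lambda>x. x = \<sigma>"] filtration(3)[OF t]
    unfolding D_def subalgebra_def by blast
  have "S \<inter> {\<omega> \<in> space M. Q (estimation_draw t \<omega>)} = (\<Union>\<sigma>\<in>?Q. D \<sigma>)"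
    unfolding D_def using estimation_draw_range by blast
  also have "prob \<dots> = (\<Sum>\<sigma>\<in>?Q. prob (D \<sigma>))"
  proof (rule finite_measure_finite_Union)
    show "finite ?Q" using finite_estimation_draws by (rule rev_finite_subset) blast
    show "D ` ?Q \<subseteq> events" using D by blast
    show "disjoint_family_on D ?Q" unfolding disjoint_family_on_def D_def by blast
  qed
  also have "\<dots> = (\<Sum>\<sigma>\<in>?Q. prob S * (\<Prod>i\<in>UNIV. \<Prod>k=1..K. p t i $ \<sigma> i k))"
    unfolding D_def using estimation_atom_indep[OF t S] by (intro sum.cong refl) blast
  finally show ?thesis by (simp only: sum_distrib_left)
qed

text \<open>
  The probability of an atom given \<open>A t\<close> is a constant, hence so is that of every event about the samples; taking
  the whole space identifies the constant.
\<close>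

lemma estimation_event_indep:
  assumes t: "t \<in> {1..T}" and S: "S \<in> sets (A t)"
  shows "prob (S \<inter> {\<omega> \<in> space M. Q (estimation_draw t \<omega>)})
    = prob {\<omega> \<in> space M. Q (estimation_draw t \<omega>)} * prob S"
proof -
  have "space M \<in> sets (A t)"
    using filtration(1)[OF t] sets.top[of "A t"] unfolding subalgebra_def by simp
  from estimation_event_prob[OF t this, of Q]
  have "prob {\<omega> \<in> space M. Q (estimation_draw t \<omega>)}
     = (\<Sum>\<sigma> | \<sigma> \<in> estimation_draws \<and> Q \<sigma>. \<Prod>i\<in>UNIV. \<Prod>k=1..K. p t i $ \<sigma> i k)"
    by (simp add: prob_space Int_def)
  with estimation_event_prob[OF t S, of Q] show ?thesis by simp
qed

lemma all_estimation_events_measurable: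
  "{\<omega> \<in> space M. \<forall>t\<in>{1..T}. Q t (estimation_draw t \<omega>)} \<in> events"
proof -
  have "{\<omega> \<in> space M. Q t (estimation_draw t \<omega>)} \<in> events" if "t \<in> {1..T}" for t
    using estimation_event_measurable[OF that, of "Q t"] filtration(3)[OF that]
    unfolding subalgebra_def by blast
  then show ?thesis by (intro sets.sets_Collect_finite_All) auto
qed

text \<open>
  The part of the accuracy event that concerns iteration \<open>t\<close>, expressed through the samples alone.  The
  quantifier over the possibly uncountable \<open>X\<close> thereby becomes harmless for measurability.
\<close>

definition accurate_draw :: "real \<Rightarrow> nat \<Rightarrow> ('m \<Rightarrow> nat \<Rightarrow> 'n) \<Rightarrow> bool" where
  "accurate_draw \<delta> t \<sigma> \<longleftrightarrow>
     (\<forall>y\<in>X. \<forall>i. \<bar>1 / real K * (\<Sum>k=1..K. F i (\<sigma> i k) y) - payoff F p t i y\<bar> \<le> \<delta>)"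

lemma accurate_iff_accurate_draws:
  "(\<forall>y\<in>X. \<forall>i. \<forall>t\<in>{1..T}. \<bar>sampled_payoff K F s t i y \<omega> - payoff F p t i y\<bar> \<le> \<delta>)
    \<longleftrightarrow> (\<forall>t\<in>{1..T}. accurate_draw \<delta> t (estimation_draw t \<omega>))"
proof -
  have "(\<Sum>k=1..K. F i (estimation_draw t \<omega> i k) y) = (\<Sum>k=1..K. F i (s t i k \<omega>) y)" for t i y
    by (intro sum.cong refl) (simp add: estimation_draw_def)
  then show ?thesis unfolding accurate_draw_def sampled_payoff_def by auto
qed

lemma accuracy_event_measurable:
  assumes "\<And>\<omega>. E \<omega> \<longleftrightarrow> (\<forall>y\<in>X. \<forall>i. \<forall>t\<in>{1..T}.
      \<bar>sampled_payoff K F s t i y \<omega> - payoff F p t i y\<bar> \<le> \<delta>)"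
  shows "{\<omega> \<in> space M. E \<omega>} \<in> events"
  unfolding assms accurate_iff_accurate_draws by (rule all_estimation_events_measurable)

section \<open>Exponential moments of the sampling noise\<close>

text \<open>
  One step of the martingale argument: the randomness is integrated out in the reverse of the order in
  which it is revealed.
  First \<open>J t\<close> is integrated out given \<open>B t\<close>, where the event about the estimation samples is already
  decided and \<open>ihat t\<close> is known; this gives the factor \<open>exp v\<close>.  Then the estimation samples are
  integrated out given \<open>A t\<close>, which gives the probability of their event.
\<close>

lemma exp_moment_one_iteration:
  assumes t: "t \<in> {1..T}"
    and p: "\<And>i. p t i \<in> prob_simplex"
    and h_meas: "\<And>i r. (\<lambda>\<omega>. h i r \<omega>) \<in> borel_measurable (A t)"
    and h_mgf: "\<And>i \<omega>. \<omega> \<in> space M \<Longrightarrow> (\<Sum>r\<in>UNIV. p t i $ r * exp (h i r \<omega>)) \<le> exp v"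
    and W: "W \<in> borel_measurable (A t)"
  shows "(\<integral>\<^sup>+\<omega>. W \<omega> * ennreal (exp (h (ihat t \<omega>) (J t \<omega>) \<omega>))
              * indicator {\<omega> \<in> space M. Q (estimation_draw t \<omega>)} \<omega> \<partial>M)
    \<le> ennreal (exp v * prob {\<omega> \<in> space M. Q (estimation_draw t \<omega>)}) * (\<integral>\<^sup>+\<omega>. W \<omega> \<partial>M)"
proof -
  define L where "L = {\<omega> \<in> space M. Q (estimation_draw t \<omega>)}"
  have subA: "subalgebra M (A t)" and subBA: "subalgebra (B t) (A t)"
    and subMB: "subalgebra M (B t)" and subMA': "subalgebra M (A (Suc t))"
    by (rule filtration[OF t])+
  have L_B: "L \<in> sets (B t)" unfolding L_def by (rule estimation_event_measurable[OF t])
  have L_M [measurable]: "L \<in> sets M" using L_B subMB by (auto simp: subalgebra_def)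
  have [measurable]: "ihat t \<in> measurable M (count_space UNIV)"
    "J t \<in> measurable M (count_space UNIV)" "W \<in> borel_measurable M"
    "\<And>i r. (\<lambda>\<omega>. h i r \<omega>) \<in> borel_measurable M"
    using measurable_from_subalg[OF subMB ihat_measurable[OF t]]
      measurable_from_subalg[OF subMA' J_measurable[OF t]]
      measurable_from_subalg[OF subA W] measurable_from_subalg[OF subA h_meas] by auto
  define I where "I i = {\<omega> \<in> space M. ihat t \<omega> = i}" for i
  define IJ where "IJ i r = {\<omega> \<in> space M. ihat t \<omega> = i \<and> J t \<omega> = r}" for i r
  have I_M [measurable]: "I i \<in> sets M" and IJ_M [measurable]: "IJ i r \<in> sets M" for i r
    unfolding I_def IJ_def by measurable
  define U where "U i r \<omega> = W \<omega> * indicator L \<omega> * ennreal (exp (h i r \<omega>))" for i r \<omega>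
  have U_B: "U i r \<in> borel_measurable (B t)" for i r
  proof -
    have [measurable]: "W \<in> borel_measurable (B t)" "(\<lambda>\<omega>. h i r \<omega>) \<in> borel_measurable (B t)"
      using measurable_from_subalg[OF subBA] W h_meas by auto
    show ?thesis unfolding U_def using L_B by measurable
  qed
  have [measurable]: "U i r \<in> borel_measurable M" for i r
    by (rule measurable_from_subalg[OF subMB U_B])
  have p0: "0 \<le> p t i $ r" for i r using p by (auto simp: prob_simplex_def)
  \<comment> \<open>splitting by the values of \<open>ihat t\<close> and \<open>J t\<close>, so that on each part the integrand is an indicator times a \<open>B t\<close>-measurable weight\<close>
  have "(\<integral>\<^sup>+\<omega>. W \<omega> * ennreal (exp (h (ihat t \<omega>) (J t \<omega>) \<omega>)) * indicator L \<omega> \<partial>M)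
      = (\<integral>\<^sup>+\<omega>. (\<Sum>i\<in>UNIV. \<Sum>r\<in>UNIV. U i r \<omega> * indicator (IJ i r) \<omega>) \<partial>M)"
  proof (intro nn_integral_cong)
    fix \<omega> assume \<omega>: "\<omega> \<in> space M"
    have "(\<Sum>i\<in>UNIV. \<Sum>r\<in>UNIV. U i r \<omega> * indicator (IJ i r) \<omega>)
        = (\<Sum>i\<in>UNIV. \<Sum>r\<in>UNIV. if r = J t \<omega> then if i = ihat t \<omega> then U i r \<omega> else 0 else 0)"
      using \<omega> by (intro sum.cong refl) (auto simp: IJ_def)
    also have "\<dots> = U (ihat t \<omega>) (J t \<omega>) \<omega>"
      by (simp add: sum.delta)
    finally show "W \<omega> * ennreal (exp (h (ihat t \<omega>) (J t \<omega>) \<omega>)) * indicator L \<omega>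
        = (\<Sum>i\<in>UNIV. \<Sum>r\<in>UNIV. U i r \<omega> * indicator (IJ i r) \<omega>)"
      by (simp add: U_def mult_ac)
  qed
  also have "\<dots> = (\<Sum>i\<in>UNIV. \<Sum>r\<in>UNIV. \<integral>\<^sup>+\<omega>. U i r \<omega> * indicator (IJ i r) \<omega> \<partial>M)"
  proof -
    have "(\<lambda>\<omega>. U i r \<omega> * indicator (IJ i r) \<omega>) \<in> borel_measurable M" for i r by measurable
    then show ?thesis by (simp only: nn_integral_sum borel_measurable_sum)
  qed
  also have "\<dots> = (\<Sum>i\<in>UNIV. \<Sum>r\<in>UNIV. ennreal (p t i $ r) * (\<integral>\<^sup>+\<omega>. U i r \<omega> * indicator (I i) \<omega> \<partial>M))"
  proof (intro sum.cong refl nn_integral_conditional_law[OF prob_space_axioms subMB IJ_M I_M p0 _ U_B])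
    fix i r S assume S: "S \<in> sets (B t)"
    then have "S \<subseteq> space M" using subMB by (auto simp: subalgebra_def dest: sets.sets_into_space)
    then have "S \<inter> IJ i r = {\<omega>\<in>S. ihat t \<omega> = i \<and> J t \<omega> = r}" "S \<inter> I i = {\<omega>\<in>S. ihat t \<omega> = i}"
      by (auto simp: IJ_def I_def)
    then show "prob (S \<inter> IJ i r) = p t i $ r * prob (S \<inter> I i)"
      using J_law[OF t S, of i r] by simp
  qed
  also have "\<dots> = (\<integral>\<^sup>+\<omega>. (\<Sum>i\<in>UNIV. \<Sum>r\<in>UNIV. ennreal (p t i $ r) * (U i r \<omega> * indicator (I i) \<omega>)) \<partial>M)"
  proof -
    have 1: "(\<lambda>\<omega>. U i r \<omega> * indicator (I i) \<omega>) \<in> borel_measurable M" for i r by measurable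
    have 2: "(\<lambda>\<omega>. ennreal (p t i $ r) * (U i r \<omega> * indicator (I i) \<omega>)) \<in> borel_measurable M" for i r
      by measurable
    show ?thesis
      by (simp only: nn_integral_sum borel_measurable_sum 2 nn_integral_cmult[OF 1])
  qed
  also have "\<dots> \<le> (\<integral>\<^sup>+\<omega>. ennreal (exp v) * (W \<omega> * indicator L \<omega>) \<partial>M)"
  proof (intro nn_integral_mono)
    fix \<omega> assume \<omega>: "\<omega> \<in> space M"
    have "(\<Sum>i\<in>UNIV. \<Sum>r\<in>UNIV. ennreal (p t i $ r) * (U i r \<omega> * indicator (I i) \<omega>))
       = (\<Sum>i\<in>UNIV. if i = ihat t \<omega> then \<Sum>r\<in>UNIV. ennreal (p t i $ r) * U i r \<omega> else 0)"
      using \<omega> by (intro sum.cong refl) (auto simp: I_def)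
    also have "\<dots> = (\<Sum>r\<in>UNIV. ennreal (p t (ihat t \<omega>) $ r) * U (ihat t \<omega>) r \<omega>)"
      by simp
    also have "\<dots> = W \<omega> * indicator L \<omega> * (\<Sum>r\<in>UNIV. ennreal (p t (ihat t \<omega>) $ r * exp (h (ihat t \<omega>) r \<omega>)))"
      by (simp add: U_def sum_distrib_left ennreal_mult p0 mult_ac)
    also have "\<dots> \<le> W \<omega> * indicator L \<omega> * ennreal (exp v)"
      using h_mgf[OF \<omega>] p0 by (intro mult_left_mono) (auto simp: sum_ennreal intro!: ennreal_leI)
    finally show "(\<Sum>i\<in>UNIV. \<Sum>r\<in>UNIV. ennreal (p t i $ r) * (U i r \<omega> * indicator (I i) \<omega>))
        \<le> ennreal (exp v) * (W \<omega> * indicator L \<omega>)"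
      by (simp only: mult.commute)
  qed
  also have "\<dots> = ennreal (exp v) * (\<integral>\<^sup>+\<omega>. W \<omega> * indicator L \<omega> \<partial>M)"
    by (simp add: nn_integral_cmult)
  also have "(\<integral>\<^sup>+\<omega>. W \<omega> * indicator L \<omega> \<partial>M)
      = ennreal (prob L) * (\<integral>\<^sup>+\<omega>. W \<omega> * indicator (space M) \<omega> \<partial>M)"
  proof (rule nn_integral_conditional_law[OF prob_space_axioms subA L_M sets.top _ _ W])
    fix S assume S: "S \<in> sets (A t)"
    then have "S \<inter> space M = S" using subA by (auto simp: subalgebra_def dest: sets.sets_into_space)
    then show "prob (S \<inter> L) = prob L * prob (S \<inter> space M)"
      using estimation_event_indep[OF t S, of Q] by (simp add: L_def)
  qed simp
  also have "(\<integral>\<^sup>+\<omega>. W \<omega> * indicator (space M) \<omega> \<partial>M) = (\<integral>\<^sup>+\<omega>. W \<omega> \<partial>M)"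
    by (intro nn_integral_cong) auto
  finally show ?thesis
    by (simp add: L_def ennreal_mult mult.assoc)
qed

text \<open>
  Iterating the one-step bound produces the product of the probabilities of the events of the single
  iterations, and by their independence this is the probability of the intersection.  The factor \<open>prob\<close> on the
  right-hand side is what makes the resulting tail bound a bound conditional on the intersection.
\<close>

lemma exp_moment_on_estimation_events:
  assumes p: "\<And>t i. t \<in> {1..T} \<Longrightarrow> p t i \<in> prob_simplex"
    and h_meas: "\<And>t i r. t \<in> {1..T} \<Longrightarrow> h t i r \<in> borel_measurable (A t)"
    and h_mgf: "\<And>t i \<omega>. t \<in> {1..T} \<Longrightarrow> \<omega> \<in> space M \<Longrightarrow>
        (\<Sum>r\<in>UNIV. p t i $ r * exp (h t i r \<omega>)) \<le> exp (v t)"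
  shows "(\<integral>\<^sup>+\<omega>. ennreal (exp (\<Sum>t=1..T. h t (ihat t \<omega>) (J t \<omega>) \<omega>))
              * indicator {\<omega> \<in> space M. \<forall>t\<in>{1..T}. Q t (estimation_draw t \<omega>)} \<omega> \<partial>M)
    \<le> ennreal (exp (\<Sum>t=1..T. v t) * prob {\<omega> \<in> space M. \<forall>t\<in>{1..T}. Q t (estimation_draw t \<omega>)})"
proof -
  define L where "L n = {\<omega> \<in> space M. \<forall>t\<in>{1..n}. Q t (estimation_draw t \<omega>)}" for n
  define V where "V n \<omega> = ennreal (exp (\<Sum>t=1..n. h t (ihat t \<omega>) (J t \<omega>) \<omega>))" for n \<omega>
  have "L n \<in> sets (A (Suc n)) \<and> V n \<in> borel_measurable (A (Suc n)) \<and>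
      (\<integral>\<^sup>+\<omega>. V n \<omega> * indicator (L n) \<omega> \<partial>M) \<le> ennreal (exp (\<Sum>t=1..n. v t) * prob (L n))"
    if "n \<le> T" for n
    using that
  proof (induction n)
    case 0
    have "space (A 1) = space M" using subalg[of 1] by (simp add: subalgebra_def)
    then have "L 0 \<in> sets (A 1)" using sets.top[of "A 1"] by (simp add: L_def)
    moreover have "V 0 = (\<lambda>_. 1)" by (simp add: V_def fun_eq_iff)
    ultimately show ?case by (simp add: L_def prob_space emeasure_space_1)
  next
    case (Suc n)
    let ?t = "Suc n"
    define R where "R = {\<omega> \<in> space M. Q ?t (estimation_draw ?t \<omega>)}"
    have t: "?t \<in> {1..T}" using Suc.prems by simp
    have IH: "L n \<in> sets (A ?t)" "V n \<in> borel_measurable (A ?t)"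
      "(\<integral>\<^sup>+\<omega>. V n \<omega> * indicator (L n) \<omega> \<partial>M) \<le> ennreal (exp (\<Sum>t=1..n. v t) * prob (L n))"
      using Suc by simp_all
    have L_Suc: "L ?t = L n \<inter> R"
      by (auto simp: L_def R_def atLeastAtMostSuc_conv)
    have V_Suc: "V ?t = (\<lambda>\<omega>. V n \<omega> * ennreal (exp (h ?t (ihat ?t \<omega>) (J ?t \<omega>) \<omega>)))"
      by (simp add: V_def fun_eq_iff exp_add ennreal_mult)
    have R_B: "R \<in> sets (B ?t)"
      unfolding R_def using estimation_event_measurable[OF t, of "Q ?t"] .
    have sub: "subalgebra (A (Suc ?t)) (A ?t)"
      using filtration(2,4)[OF t] by (auto simp: subalgebra_def)
    have "L ?t \<in> sets (A (Suc ?t))"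
      unfolding L_Suc using IH(1) R_B sub filtration(4)[OF t] by (auto simp: subalgebra_def)
    moreover have "V ?t \<in> borel_measurable (A (Suc ?t))"
    proof -
      have [measurable]: "V n \<in> borel_measurable (A (Suc ?t))"
        "\<And>i r. h ?t i r \<in> borel_measurable (A (Suc ?t))"
        "ihat ?t \<in> measurable (A (Suc ?t)) (count_space UNIV)"
        "J ?t \<in> measurable (A (Suc ?t)) (count_space UNIV)"
        using measurable_from_subalg[OF sub IH(2)] measurable_from_subalg[OF sub h_meas[OF t]]
          measurable_from_subalg[OF filtration(4)[OF t] ihat_measurable[OF t]] J_measurable[OF t]
        by blast+
      have "(\<lambda>\<omega>. h ?t i (J ?t \<omega>) \<omega>) \<in> borel_measurable (A (Suc ?t))" for i
        by (rule measurable_compose_countable) simp_all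
      then have [measurable]: "(\<lambda>\<omega>. h ?t (ihat ?t \<omega>) (J ?t \<omega>) \<omega>) \<in> borel_measurable (A (Suc ?t))"
        by (rule measurable_compose_countable) simp_all
      show ?thesis unfolding V_Suc by measurable
    qed
    moreover have "(\<integral>\<^sup>+\<omega>. V ?t \<omega> * indicator (L ?t) \<omega> \<partial>M)
        \<le> ennreal (exp (\<Sum>t=1..?t. v t) * prob (L ?t))"
    proof -
      have "(\<integral>\<^sup>+\<omega>. V ?t \<omega> * indicator (L ?t) \<omega> \<partial>M)
          = (\<integral>\<^sup>+\<omega>. (V n \<omega> * indicator (L n) \<omega>) * ennreal (exp (h ?t (ihat ?t \<omega>) (J ?t \<omega>) \<omega>))
              * indicator R \<omega> \<partial>M)"
        unfolding L_Suc V_Suc by (simp add: indicator_inter_arith mult_ac)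
      also have "\<dots> \<le> ennreal (exp (v ?t) * prob R) * (\<integral>\<^sup>+\<omega>. V n \<omega> * indicator (L n) \<omega> \<partial>M)"
        unfolding R_def using IH(1,2)
        by (intro exp_moment_one_iteration[OF t p[OF t] h_meas[OF t] h_mgf[OF t]]) auto
      also have "\<dots> \<le> ennreal (exp (v ?t) * prob R) * ennreal (exp (\<Sum>t=1..n. v t) * prob (L n))"
        by (rule mult_left_mono[OF IH(3)]) simp
      also have "\<dots> = ennreal (exp (v ?t) * prob R * (exp (\<Sum>t=1..n. v t) * prob (L n)))"
        by (subst ennreal_mult[symmetric]) simp_all
      also have "exp (v ?t) * prob R * (exp (\<Sum>t=1..n. v t) * prob (L n))
          = exp (\<Sum>t=1..?t. v t) * (prob R * prob (L n))"
        by (simp add: exp_add)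
      also have "prob R * prob (L n) = prob (L ?t)"
        unfolding L_Suc R_def using estimation_event_indep[OF t IH(1), of "Q ?t"] by simp
      finally show ?thesis .
    qed
    ultimately show ?case by blast
  qed
  from this[of T] show ?thesis by (simp add: L_def V_def)
qed

lemma sum_increments_measurable:
  assumes h: "\<And>t i r. t \<in> {1..T} \<Longrightarrow> h t i r \<in> borel_measurable (A t)"
  shows "(\<lambda>\<omega>. \<Sum>t=1..T. h t (ihat t \<omega>) (J t \<omega>) \<omega> :: real) \<in> borel_measurable M"
proof (rule borel_measurable_sum)
  fix t assume t: "t \<in> {1..T}"
  have [measurable]: "\<And>i r. h t i r \<in> borel_measurable M"
    "ihat t \<in> measurable M (count_space UNIV)" "J t \<in> measurable M (count_space UNIV)"
    using measurable_from_subalg[OF filtration(1)[OF t] h[OF t]]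
      measurable_from_subalg[OF filtration(3)[OF t] ihat_measurable[OF t]]
      measurable_from_subalg[OF filtration(5)[OF t] J_measurable[OF t]]
    by blast+
  have "(\<lambda>\<omega>. h t i (J t \<omega>) \<omega>) \<in> borel_measurable M" for i
    by (rule measurable_compose_countable) simp_all
  then show "(\<lambda>\<omega>. h t (ihat t \<omega>) (J t \<omega>) \<omega>) \<in> borel_measurable M"
    by (rule measurable_compose_countable) simp_all
qed

text \<open>
  Markov's inequality applied to the exponential of the noise, restricted to the intersection of the estimation events.
\<close>

lemma tail_on_estimation_events:
  assumes p: "\<And>t i. t \<in> {1..T} \<Longrightarrow> p t i \<in> prob_simplex"
    and h_meas: "\<And>t i r. t \<in> {1..T} \<Longrightarrow> h t i r \<in> borel_measurable (A t)"
    and h_mgf: "\<And>t i \<omega>. t \<in> {1..T} \<Longrightarrow> \<omega> \<in> space M \<Longrightarrow>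
        (\<Sum>r\<in>UNIV. p t i $ r * exp (h t i r \<omega>)) \<le> exp (v t)"
  shows "prob {\<omega> \<in> space M. (\<forall>t\<in>{1..T}. Q t (estimation_draw t \<omega>)) \<and>
              u < (\<Sum>t=1..T. h t (ihat t \<omega>) (J t \<omega>) \<omega>)}
    \<le> exp ((\<Sum>t=1..T. v t) - u) * prob {\<omega> \<in> space M. \<forall>t\<in>{1..T}. Q t (estimation_draw t \<omega>)}"
proof -
  define L where "L = {\<omega> \<in> space M. \<forall>t\<in>{1..T}. Q t (estimation_draw t \<omega>)}"
  define Z where "Z \<omega> = (\<Sum>t=1..T. h t (ihat t \<omega>) (J t \<omega>) \<omega>)" for \<omega>
  have L [measurable]: "L \<in> events"
    unfolding L_def by (rule all_estimation_events_measurable)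
  have Z [measurable]: "Z \<in> borel_measurable M"
    unfolding Z_def by (rule sum_increments_measurable[OF h_meas])
  have "ennreal (prob {\<omega> \<in> space M. \<omega> \<in> L \<and> u < Z \<omega>})
      = (\<integral>\<^sup>+\<omega>. indicator {\<omega> \<in> space M. \<omega> \<in> L \<and> u < Z \<omega>} \<omega> \<partial>M)"
    by (subst nn_integral_indicator) (simp_all add: emeasure_eq_measure)
  also have "\<dots> \<le> (\<integral>\<^sup>+\<omega>. ennreal (exp (- u)) * (ennreal (exp (Z \<omega>)) * indicator L \<omega>) \<partial>M)"
  proof (rule nn_integral_mono)
    fix \<omega>
    have "1 \<le> ennreal (exp (- u)) * ennreal (exp (Z \<omega>))" if "u < Z \<omega>"
      using that by (simp flip: ennreal_mult exp_add)
    then show "indicator {\<omega> \<in> space M. \<omega> \<in> L \<and> u < Z \<omega>} \<omega>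
        \<le> ennreal (exp (- u)) * (ennreal (exp (Z \<omega>)) * indicator L \<omega>)"
      by (auto split: split_indicator)
  qed
  also have "\<dots> = ennreal (exp (- u)) * (\<integral>\<^sup>+\<omega>. ennreal (exp (Z \<omega>)) * indicator L \<omega> \<partial>M)"
    by (rule nn_integral_cmult) measurable
  also have "\<dots> \<le> ennreal (exp (- u)) * ennreal (exp (\<Sum>t=1..T. v t) * prob L)"
    unfolding Z_def L_def
    using exp_moment_on_estimation_events[where h = h and v = v and Q = Q, OF p h_meas h_mgf]
    by (intro mult_left_mono) simp_all
  also have "\<dots> = ennreal (exp ((\<Sum>t=1..T. v t) - u) * prob L)"
    by (simp add: exp_diff exp_minus divide_inverse mult_ac flip: ennreal_mult)
  finally have "prob {\<omega> \<in> space M. \<omega> \<in> L \<and> u < Z \<omega>} \<le> exp ((\<Sum>t=1..T. v t) - u) * prob L"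
    by (simp add: ennreal_le_iff)
  moreover have "{\<omega> \<in> space M. \<omega> \<in> L \<and> u < Z \<omega>}
      = {\<omega> \<in> space M. (\<forall>t\<in>{1..T}. Q t (estimation_draw t \<omega>)) \<and> u < Z \<omega>}"
    by (auto simp: L_def)
  ultimately show ?thesis by (simp only: L_def Z_def)
qed

end

section \<open>The rate of the step sizes\<close>

text \<open>
  A lower bound on \<open>ln 2\<close> of this quality is needed for \<open>T = 2\<close> in \<open>regret_rate_constant\<close>, where \<open>2 / 3\<close> would be too small.
\<close>

lemma ln2_ge_17_25: "17 / 25 \<le> ln (2::real)"
proof -
  have "exp (17 / 25 * 25) = (exp 1 :: real) ^ 17"
    using exp_of_nat_mult[of 17 "1::real"] by simp
  also have "\<dots> \<le> (272 / 100) ^ 17"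
    using e_less_272 by (intro power_mono) auto
  also have "\<dots> \<le> (2::real) ^ 25" by (simp add: field_simps)
  also have "\<dots> = exp (ln 2 * 25)"
    using exp_of_nat_mult[of 25 "ln 2 :: real"] by (simp add: mult.commute)
  finally show ?thesis by simp
qed

text \<open>
  The integral bound for the sum, by induction: \<open>2 * sqrt\<close> is concave with derivative \<open>1 / sqrt\<close>.
\<close>

lemma sum_inverse_sqrt_ge: "2 * sqrt (real T + 1) - 2 \<le> (\<Sum>t=1..T. 1 / sqrt (real t))"
proof (induction T)
  case (Suc T)
  define b where "b = sqrt (real T + 1)"
  define a where "a = sqrt (real T + 2)"
  have b: "b > 0" and "a\<^sup>2 = b\<^sup>2 + 1" by (simp_all add: a_def b_def)
  then have "2 * (a * b) \<le> 2 * b\<^sup>2 + 1"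
    using sum_squares_bound[of a b] by simp
  then have "2 * a \<le> 2 * b + 1 / b"
    using b by (simp add: field_simps power2_eq_square)
  then show ?case
    using Suc.IH by (simp add: a_def b_def add.commute)
qed simp

text \<open>
  The left-hand side is what mirror descent and the tail bound give, up to common factors.  For large \<open>T\<close>
  it is of order \<open>ln T * sqrt T\<close>, as is the right-hand side, and from \<open>T = 3\<close> on crude bounds suffice.
  For \<open>T = 2\<close> the inequality is nearly sharp when \<open>\<Omega>\<close> is large, and for small \<open>\<Omega>\<close> the gain from
  \<open>ln 2 / \<Omega>\<close> has to compensate for \<open>H / (2 * \<Omega>)\<close>.
\<close>

lemma regret_rate_constant:
  fixes T :: nat and \<Omega> H S :: real
  defines "H \<equiv> \<Sum>t=1..T. 1 / real t" and "S \<equiv> \<Sum>t=1..T. 1 / sqrt (real t)"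
  assumes T: "T \<ge> 2" and \<Omega>: "\<Omega> \<ge> 1"
  shows "(1 + H / (2 * \<Omega>) + 2 * sqrt (H * (1 - ln 2 / \<Omega>))) * sqrt (real T)
    \<le> 3 * sqrt 2 * ln (real T) * S"
proof (cases "T = 2")
  case True
  have H: "H = 3 / 2" and S: "S = 1 + 1 / sqrt 2"
    by (simp_all add: H_def S_def True numeral_2_eq_2)
  define v where "v = 1 / \<Omega>"
  have v: "0 \<le> v" "v \<le> 1" using \<Omega> by (simp_all add: v_def)
  have s6: "sqrt 6 \<le> 2.45" "2.4 \<le> sqrt 6"
    by (intro real_le_lsqrt real_le_rsqrt; simp add: power2_eq_square)+
  have s2: "1 / sqrt 2 \<ge> (0.7 :: real)"
  proof -
    have "sqrt 2 \<le> 1 / 0.7" by (intro real_le_lsqrt) (simp_all add: power2_eq_square)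
    then show ?thesis by (simp add: field_simps)
  qed
  have l1: "ln 2 \<le> (1::real)" using ln_le_minus_one[of "2::real"] by simp
  have w: "0 \<le> 1 - ln 2 * v" using mult_mono[OF l1 v(2)] v by simp
  \<comment> \<open>linearized at \<open>v = 0\<close>, the gain \<open>sqrt 6 * ln 2 / 2\<close> per unit of \<open>v\<close> exceeds the cost \<open>3 / 4\<close>\<close>
  have "sqrt (1 - ln 2 * v) \<le> 1 - ln 2 * v / 2"
    using w zero_le_power2[of "ln 2 * v"]
    by (intro real_le_lsqrt) (simp_all add: power2_diff power_divide)
  then have "sqrt 6 * sqrt (1 - ln 2 * v) \<le> sqrt 6 * (1 - ln 2 * v / 2)"
    by (rule mult_left_mono) simp
  moreover have "2.4 * (17 / 25) \<le> sqrt 6 * ln 2" using s6 ln2_ge_17_25 by (intro mult_mono) auto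
  then have "2.4 * (17 / 25) * v \<le> sqrt 6 * ln 2 * v" using v(1) by (rule mult_right_mono)
  ultimately have "1 + 3 / 4 * v + sqrt 6 * sqrt (1 - ln 2 * v) \<le> 1 + sqrt 6"
    using v by (simp add: algebra_simps)
  also have "\<dots> \<le> 3 * (17 / 25) * (1 + 0.7)" using s6 by simp
  also have "\<dots> \<le> 3 * ln 2 * (1 + 1 / sqrt 2)" using ln2_ge_17_25 s2 by (intro mult_mono) auto
  finally have "(1 + 3 / 4 * v + sqrt 6 * sqrt (1 - ln 2 * v)) * sqrt 2
      \<le> 3 * ln 2 * (1 + 1 / sqrt 2) * sqrt 2"
    by (rule mult_right_mono) simp
  moreover have v_sqrt: "2 * sqrt (H * (1 - ln 2 / \<Omega>)) = sqrt 6 * sqrt (1 - ln 2 * v)"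
  proof -
    have "2 * sqrt (H * (1 - ln 2 / \<Omega>)) = sqrt (4 * (H * (1 - ln 2 * v)))"
      by (simp only: real_sqrt_mult real_sqrt_four) (simp add: v_def)
    also have "4 * (H * (1 - ln 2 * v)) = 6 * (1 - ln 2 * v)" by (simp add: H)
    finally show ?thesis by (simp only: real_sqrt_mult)
  qed
  moreover have v_H: "H / (2 * \<Omega>) = 3 / 4 * v" by (simp add: H v_def)
  ultimately show ?thesis unfolding v_sqrt v_H S True by (simp only: of_nat_numeral mult_ac)
next
  case False
  with T have T3: "real T \<ge> 3" by simp
  define L where "L = ln (real T)"
  have L: "L \<ge> 1"
  proof -
    have "exp 1 \<le> real T" using e_less_272 T3 by simp
    then have "ln (exp 1) \<le> L" unfolding L_def using T3 by (subst ln_le_cancel_iff) auto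
    then show ?thesis by simp
  qed
  have H: "0 \<le> H" "H \<le> 1 + L"
  proof -
    show "0 \<le> H" by (simp add: H_def sum_nonneg)
    have "harm T - ln (of_nat T) \<le> harm 1 - ln (of_nat 1 :: real)"
      using T by (intro euler_mascheroni_sequence_decreasing) auto
    then show "H \<le> 1 + L" by (simp add: harm_def H_def L_def inverse_eq_divide)
  qed
  have l: "0 \<le> ln (2::real)" "ln 2 \<le> \<Omega>" using ln_le_minus_one[of "2::real"] \<Omega> by auto
  have "H * (1 - ln 2 / \<Omega>) \<le> 1 + L"
    using H l \<Omega> mult_left_le[of "1 - ln 2 / \<Omega>" H] by simp
  then have "2 * sqrt (H * (1 - ln 2 / \<Omega>)) \<le> 2 * sqrt (1 + L)" by simp
  \<comment> \<open>arithmetic-geometric mean inequality with \<open>29 / 20\<close>, which is close to \<open>sqrt (1 + ln 3)\<close>\<close>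
  also have "\<dots> \<le> 20 / 29 * L + (20 / 29 + 29 / 20)"
    using sum_squares_bound[of "sqrt (1 + L)" "29 / 20"] L by (simp add: field_simps power2_eq_square)
  finally have "2 * sqrt (H * (1 - ln 2 / \<Omega>)) \<le> 20 / 29 * L + (20 / 29 + 29 / 20)" .
  moreover have "H / (2 * \<Omega>) \<le> H / 2"
    using H \<Omega> by (intro divide_left_mono) auto
  moreover have "1 + a + b \<le> 48783 / 10000 * L" if "b \<le> 20 / 29 * L + (20 / 29 + 29 / 20)" "a \<le> H / 2" for a b
    using that H L by linarith
  ultimately have "1 + H / (2 * \<Omega>) + 2 * sqrt (H * (1 - ln 2 / \<Omega>)) \<le> 48783 / 10000 * L"
    by blast
  then have "(1 + H / (2 * \<Omega>) + 2 * sqrt (H * (1 - ln 2 / \<Omega>))) * sqrt (real T)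
      \<le> 48783 / 10000 * L * sqrt (real T)"
    by (rule mult_right_mono) simp
  also have "\<dots> \<le> 3 * sqrt 2 * L * S"
  proof -
    have s2: "1.414 \<le> sqrt 2" by (rule real_le_rsqrt) (simp add: power2_eq_square)
    have r: "1.72 \<le> sqrt (real T)" using T3 by (intro real_le_rsqrt) (simp add: power2_eq_square)
    have "2 + (23 / 20) * sqrt (real T) \<le> sqrt (4 * (real T + 1))"
    proof (rule real_le_rsqrt)
      have "1.72 * sqrt (real T) \<le> sqrt (real T) * sqrt (real T)"
        using r by (intro mult_right_mono) auto
      then have "1.72 * sqrt (real T) \<le> real T" by simp
      moreover have "(2 + (23 / 20) * sqrt (real T))\<^sup>2 = 4 + 23 / 5 * sqrt (real T) + 529 / 400 * real T"
        by (simp add: power2_sum power_mult_distrib power_divide)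
      ultimately show "(2 + (23 / 20) * sqrt (real T))\<^sup>2 \<le> 4 * (real T + 1)" by simp
    qed
    also have "\<dots> = 2 * sqrt (real T + 1)" by (simp only: real_sqrt_mult real_sqrt_four)
    finally have "(23 / 20) * sqrt (real T) \<le> S" using sum_inverse_sqrt_ge[of T] by (simp add: S_def)
    moreover have "(2121 / 500) * L \<le> 3 * sqrt 2 * L" using s2 L by (intro mult_right_mono) auto
    ultimately show ?thesis
      using L mult_mono[of "(2121 / 500) * L" "3 * sqrt 2 * L" "(23 / 20) * sqrt (real T)" S] by simp
  qed
  finally show ?thesis by (simp add: L_def)
qed

section \<open>The regret of stochastic mirror descent\<close>

context eps_smd
begin

lemma iterate_in_domain:
  assumes "t \<in> {1..Suc T}" "\<omega> \<in> space M"
  shows "x t \<omega> \<in> X"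
proof (cases t)
  case (Suc n)
  show ?thesis
  proof (cases "n = 0")
    case True
    then show ?thesis using init assms(2) Suc by auto
  next
    case False
    then show ?thesis
      using x_update[of n \<omega>] assms Suc by (auto simp: is_arg_min_def)
  qed
qed (use assms in simp)

lemma borel_measurable_iterate:
  assumes t: "t \<in> {1..Suc T}" and f: "continuous_on X (f :: 'a \<Rightarrow> real)"
  shows "(\<lambda>\<omega>. f (x t \<omega>)) \<in> borel_measurable (A t)"
proof -
  have "space (A t) = space M" using subalg[OF t] by (simp add: subalgebra_def)
  then have "x t \<in> measurable (A t) (restrict_space borel X)"
    using x_measurable[OF t] iterate_in_domain[OF t] by (intro measurable_restrict_space2) auto
  from measurable_compose[OF this borel_measurable_continuous_on_restrict[OF f]] show ?thesis .
qed

text \<open>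
  With \<open>\<delta>\<close> half the allowed estimation loss, the noise is required to stay below \<open>D * v\<close>, where \<open>v\<close> is
  chosen such that the optimal exponential tilt \<open>l\<close> makes the tail bound exactly \<open>2 * exp (- \<Omega>)\<close>.  The step size
  constant balances the sum of the squared step sizes against \<open>D\<close>, so that \<open>D\<close> factors out of all three
  contributions: initial divergence, squared steps, and noise.
\<close>

lemma regret_tail_on_estimation_events:
  fixes N :: "'a \<Rightarrow> real"
  assumes X: "closed X" "convex X"
    and N: "is_norm N" and G: "G > 0"
    and F_lipschitz: "\<And>i r y z. y \<in> X \<Longrightarrow> z \<in> X \<Longrightarrow> \<bar>F i r y - F i r z\<bar> \<le> G * N (y - z)"
    and p: "\<And>t i. t \<in> {1..T} \<Longrightarrow> p t i \<in> prob_simplex"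
    and \<psi>: "\<And>y. y \<in> X \<Longrightarrow> (\<psi> has_derivative (\<lambda>h. d\<psi> y \<bullet> h)) (at y within X)"
    and sc: "strongly_convex_on X N 1 \<psi>"
    and D: "D > 0" "\<And>y z. y \<in> X \<Longrightarrow> z \<in> X \<Longrightarrow> bregman \<psi> d\<psi> y z \<le> D"
    and \<Omega>: "\<Omega> \<ge> 1" and T: "T \<ge> 2"
    and \<alpha>: "\<And>t. \<alpha> t = 1 / G * sqrt (D / \<Omega>) / sqrt (real t)"
    and \<theta>: "\<And>t. \<theta> t = \<alpha> t / (\<Sum>\<tau>=1..T. \<alpha> \<tau>)"
    and g: "\<And>t \<omega>. t \<in> {1..T} \<Longrightarrow> \<omega> \<in> space M \<Longrightarrow> dual_norm N (g t \<omega>) \<le> G"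
    and E: "\<And>\<omega>. E \<omega> \<longleftrightarrow> (\<forall>y\<in>X. \<forall>i. \<forall>t\<in>{1..T}.
          \<bar>sampled_payoff K F s t i y \<omega> - payoff F p t i y\<bar> \<le> \<delta>)"
  shows "prob {\<omega> \<in> space M. E \<omega> \<and>
      \<not> weighted_regret X T \<theta> (max_payoff F p) (\<lambda>t. x t \<omega>)
          \<le> 3 * sqrt \<Omega> * G * ln (real T) * sqrt (2 * D) / sqrt (real T) + 2 * \<delta>}
    \<le> 2 * exp (- \<Omega>) * prob {\<omega> \<in> space M. E \<omega>}"
proof -
  define c where "c = 1 / G * sqrt (D / \<Omega>)"
  define H where "H = (\<Sum>t=1..T. 1 / real t)"
  define S where "S = (\<Sum>t=1..T. 1 / sqrt (real t))"
  define v where "v = 2 * sqrt (H * (1 - ln 2 / \<Omega>))"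
  define l where "l = v * \<Omega> / (2 * D * H)"
  have c: "c > 0" "c\<^sup>2 = D / (G\<^sup>2 * \<Omega>)"
    using D(1) \<Omega> G by (simp_all add: c_def power_mult_distrib power_divide)
  have H: "H > 0" unfolding H_def using T by (intro sum_pos) auto
  have S: "S > 0" unfolding S_def using T by (intro sum_pos) auto
  have ln2: "ln 2 < \<Omega>" using \<Omega> ln2_le_25_over_36 by linarith
  have v: "v > 0" "v\<^sup>2 = 4 * H * (1 - ln 2 / \<Omega>)"
    using H ln2 \<Omega> by (simp_all add: v_def power_mult_distrib)
  have l: "l > 0" using v D(1) \<Omega> H by (simp add: l_def)
  have \<alpha>_c: "\<alpha> t = c / sqrt (real t)" for t by (simp only: \<alpha> c_def)
  have \<alpha>_pos: "\<alpha> t > 0" if "t \<in> {1..T}" for t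
    using that c by (simp add: \<alpha>_c)
  have sum_\<alpha>: "(\<Sum>t=1..T. \<alpha> t) = c * S"
    by (simp add: \<alpha>_c S_def sum_distrib_left)
  have sum_\<alpha>2: "(\<Sum>t=1..T. (\<alpha> t)\<^sup>2) = c\<^sup>2 * H"
    by (simp add: \<alpha>_c H_def sum_distrib_left power_divide)

  obtain \<omega>\<^sub>0 where \<omega>\<^sub>0: "\<omega>\<^sub>0 \<in> space M" using not_empty by blast
  have x\<^sub>1: "x 1 \<omega>\<^sub>0 \<in> X" using \<omega>\<^sub>0 by (intro iterate_in_domain) auto
  have diam: "N (y - z) \<le> sqrt (2 * D)" if "y \<in> X" "z \<in> X" for y z
  proof -
    have "(N (y - z))\<^sup>2 / 2 \<le> bregman \<psi> d\<psi> y z"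
      by (rule bregman_ge[OF N X(2) that(2,1) _ sc]) (rule \<psi>[OF that(2)])
    with D(2)[OF that] show ?thesis by (intro real_le_rsqrt) linarith
  qed
  have F_diff: "\<bar>F i r y - F i r z\<bar> \<le> G * sqrt (2 * D)" if "y \<in> X" "z \<in> X" for i r y z
    using F_lipschitz[OF that, of i r] mult_left_mono[OF diam[OF that], of G] G by linarith
  have F_cont: "continuous_on X (F i r)" for i r
    using G by (intro continuous_on_is_norm_lipschitz[OF N _ F_lipschitz]) auto
  have payoff_cont: "continuous_on X (payoff F p t i)" for t i
    unfolding payoff_eq_sum by (intro continuous_intros F_cont)
  have max_cont: "continuous_on X (max_payoff F p t)" if "t \<in> {1..T}" for t
    using F_lipschitz p[OF that] by (rule continuous_on_max_payoff[OF N G])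

  have "bounded X"
  proof -
    obtain C where C: "C > 0" "\<And>y. norm y \<le> C * N y" using norm_le_is_norm[OF N] by blast
    have "dist (x 1 \<omega>\<^sub>0) y \<le> C * sqrt (2 * D)" if "y \<in> X" for y
      using C(2)[of "x 1 \<omega>\<^sub>0 - y"] mult_left_mono[OF diam[OF x\<^sub>1 that] less_imp_le[OF C(1)]]
      by (simp add: dist_norm)
    then show ?thesis unfolding bounded_def by blast
  qed
  then have "compact X" using X(1) by (simp add: compact_eq_bounded_closed)
  moreover have "continuous_on X (\<lambda>y. \<Sum>t=1..T. \<theta> t * max_payoff F p t y)"
    by (intro continuous_intros max_cont)
  ultimately obtain y where y: "y \<in> X"
    "\<And>z. z \<in> X \<Longrightarrow> (\<Sum>t=1..T. \<theta> t * max_payoff F p t y) \<le> (\<Sum>t=1..T. \<theta> t * max_payoff F p t z)"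
    using continuous_attains_inf[of X "\<lambda>y. \<Sum>t=1..T. \<theta> t * max_payoff F p t y"] x\<^sub>1 by blast
  have INF: "(INF z\<in>X. \<Sum>t=1..T. \<theta> t * max_payoff F p t z) = (\<Sum>t=1..T. \<theta> t * max_payoff F p t y)"
    using y by (intro cInf_eq_minimum) auto

  \<comment> \<open>the tilted noise of iteration \<open>t\<close>, were \<open>i\<close> selected and scenario \<open>r\<close> drawn\<close>
  define h where "h t i r \<omega> = l * \<alpha> t *
      ((payoff F p t i (x t \<omega>) - payoff F p t i y) - (F i r (x t \<omega>) - F i r y))" for t i r \<omega>
  have h_meas: "h t i r \<in> borel_measurable (A t)" if "t \<in> {1..T}" for t i r
  proof -
    have t': "t \<in> {1..Suc T}" using that by simp
    have [measurable]: "(\<lambda>\<omega>. payoff F p t i (x t \<omega>)) \<in> borel_measurable (A t)"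
      "(\<lambda>\<omega>. F i r (x t \<omega>)) \<in> borel_measurable (A t)"
      by (rule borel_measurable_iterate[OF t' payoff_cont] borel_measurable_iterate[OF t' F_cont])+
    show ?thesis unfolding h_def by measurable
  qed
  have h_mgf: "(\<Sum>r\<in>UNIV. p t i $ r * exp (h t i r \<omega>)) \<le> exp (l\<^sup>2 * (\<alpha> t)\<^sup>2 * (G\<^sup>2 * D))"
    if t: "t \<in> {1..T}" and \<omega>: "\<omega> \<in> space M" for t i \<omega>
  proof -
    have xX: "x t \<omega> \<in> X" using t \<omega> by (intro iterate_in_domain) auto
    have "(\<Sum>r\<in>UNIV. p t i $ r * exp (l * \<alpha> t *
          ((\<Sum>r\<in>UNIV. p t i $ r * (F i r (x t \<omega>) - F i r y)) - (F i r (x t \<omega>) - F i r y))))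
        \<le> exp ((l * \<alpha> t)\<^sup>2 * (G * sqrt (2 * D))\<^sup>2 / 2)"
      using l \<alpha>_pos[OF t] by (intro hoeffding_finite_exp p[OF t] F_diff xX y) simp
    moreover have "(\<Sum>r\<in>UNIV. p t i $ r * (F i r (x t \<omega>) - F i r y))
        = payoff F p t i (x t \<omega>) - payoff F p t i y"
      by (simp add: payoff_eq_sum right_diff_distrib sum_subtractf)
    moreover have "(l * \<alpha> t)\<^sup>2 * (G * sqrt (2 * D))\<^sup>2 / 2 = l\<^sup>2 * (\<alpha> t)\<^sup>2 * (G\<^sup>2 * D)"
      using D(1) by (simp add: power_mult_distrib)
    ultimately show ?thesis by (simp add: h_def)
  qed

  define Q where "Q = accurate_draw \<delta>"
  have E_iff: "E \<omega> \<longleftrightarrow> (\<forall>t\<in>{1..T}. Q t (estimation_draw t \<omega>))" for \<omega>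
    unfolding E Q_def by (rule accurate_iff_accurate_draws)

  have regret_le: "weighted_regret X T \<theta> (max_payoff F p) (\<lambda>t. x t \<omega>)
      \<le> 3 * sqrt \<Omega> * G * ln (real T) * sqrt (2 * D) / sqrt (real T) + 2 * \<delta>"
    if \<omega>: "\<omega> \<in> space M" "E \<omega>" and Z: "(\<Sum>t=1..T. h t (ihat t \<omega>) (J t \<omega>) \<omega>) \<le> l * (D * v)" for \<omega>
  proof -
    define gap where "gap t = max_payoff F p t (x t \<omega>) - max_payoff F p t y" for t
    have "\<alpha> t * gap t \<le> 2 * \<delta> * \<alpha> t + h t (ihat t \<omega>) (J t \<omega>) \<omega> / l + \<alpha> t * (g t \<omega> \<bullet> (x t \<omega> - y))"
      if t: "t \<in> {1..T}" for t
    proof -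
      have xX: "x t \<omega> \<in> X" using t \<omega> by (intro iterate_in_domain) auto
      have "gap t \<le> 2 * \<delta> + (payoff F p t (ihat t \<omega>) (x t \<omega>) - payoff F p t (ihat t \<omega>) y)"
        unfolding gap_def using \<omega>(2) xX t unfolding E
        by (intro max_payoff_gap_le[OF _ ihat_argmax[OF t \<omega>(1)]]) auto
      moreover have "F (ihat t \<omega>) (J t \<omega>) (x t \<omega>) - F (ihat t \<omega>) (J t \<omega>) y \<le> g t \<omega> \<bullet> (x t \<omega> - y)"
        using g_subgradient[OF t \<omega>(1)] y(1)
        by (auto simp: subdifferential_def inner_diff_right dest!: bspec[of X _ y])
      ultimately have "gap t \<le> 2 * \<delta> + h t (ihat t \<omega>) (J t \<omega>) \<omega> / (l * \<alpha> t) + g t \<omega> \<bullet> (x t \<omega> - y)"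
        using l \<alpha>_pos[OF t] by (simp add: h_def)
      from mult_left_mono[OF this less_imp_le[OF \<alpha>_pos[OF t]]] show ?thesis
        using l \<alpha>_pos[OF t] by (simp add: distrib_left mult_ac)
    qed
    then have "(\<Sum>t=1..T. \<alpha> t * gap t) \<le> (\<Sum>t=1..T. 2 * \<delta> * \<alpha> t
        + h t (ihat t \<omega>) (J t \<omega>) \<omega> / l + \<alpha> t * (g t \<omega> \<bullet> (x t \<omega> - y)))"
      by (rule sum_mono)
    also have "\<dots> = 2 * \<delta> * (c * S) + (\<Sum>t=1..T. h t (ihat t \<omega>) (J t \<omega>) \<omega>) / l
        + (\<Sum>t=1..T. \<alpha> t * (g t \<omega> \<bullet> (x t \<omega> - y)))"
      by (simp only: sum.distrib sum_distrib_left sum_divide_distrib flip: sum_\<alpha>)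
    also have "(\<Sum>t=1..T. h t (ihat t \<omega>) (J t \<omega>) \<omega>) / l \<le> D * v"
      using Z l by (simp add: pos_divide_le_eq mult.commute)
    also have "(\<Sum>t=1..T. \<alpha> t * (g t \<omega> \<bullet> (x t \<omega> - y))) \<le> D + G\<^sup>2 / 2 * (c\<^sup>2 * H)"
      unfolding sum_\<alpha>2[symmetric]
      by (rule mirror_descent_sum_le[where x = "\<lambda>t. x t \<omega>" and g = "\<lambda>t. g t \<omega>" and \<alpha> = \<alpha>
          and \<psi> = \<psi> and d\<psi> = d\<psi> and N = N and X = X and T = T, OF N X(2) \<psi> sc D(2) iterate_in_domain[OF _ \<omega>(1)] y(1)
          \<alpha>_pos g[OF _ \<omega>(1)] x_update[OF _ \<omega>(1)]])
    also have "G\<^sup>2 / 2 * (c\<^sup>2 * H) = D * (H / (2 * \<Omega>))" using G by (simp add: c(2))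
    finally have "(\<Sum>t=1..T. \<alpha> t * gap t) \<le> 2 * \<delta> * (c * S) + D * (1 + H / (2 * \<Omega>) + v)"
      by (simp add: algebra_simps)
    moreover have "weighted_regret X T \<theta> (max_payoff F p) (\<lambda>t. x t \<omega>) = (\<Sum>t=1..T. \<alpha> t * gap t) / (c * S)"
      unfolding weighted_regret_def INF
      by (simp only: \<theta> sum_\<alpha> gap_def right_diff_distrib sum_subtractf diff_divide_distrib
          sum_divide_distrib times_divide_eq_left)
    ultimately have "weighted_regret X T \<theta> (max_payoff F p) (\<lambda>t. x t \<omega>)
        \<le> 2 * \<delta> + D * (1 + H / (2 * \<Omega>) + v) / (c * S)"
      using c S by (simp add: pos_divide_le_eq distrib_right)
    also have "D * (1 + H / (2 * \<Omega>) + v) / (c * S)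
        \<le> 3 * sqrt \<Omega> * G * ln (real T) * sqrt (2 * D) / sqrt (real T)"
    proof -
      have "1 + H / (2 * \<Omega>) + v \<le> 3 * sqrt 2 * ln (real T) * S / sqrt (real T)"
        using regret_rate_constant[OF T \<Omega>] T by (simp add: H_def S_def v_def pos_le_divide_eq)
      then have "D * (1 + H / (2 * \<Omega>) + v) / (c * S)
          \<le> D * (3 * sqrt 2 * ln (real T) * S / sqrt (real T)) / (c * S)"
        using D(1) c S by (intro divide_right_mono mult_left_mono) auto
      also have "\<dots> = 3 * sqrt 2 * ln (real T) / sqrt (real T) * (D / c)"
        using S by simp
      also have "D / c = G * sqrt D * sqrt \<Omega>"
        using D(1) \<Omega> G by (simp add: c_def real_sqrt_divide field_simps)
      finally show ?thesis by (simp add: real_sqrt_mult mult_ac)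
    qed
    finally show ?thesis by simp
  qed

  \<comment> \<open>pathwise, too large a regret on \<open>E\<close> forces the noise above its threshold\<close>
  have "prob {\<omega> \<in> space M. E \<omega> \<and>
      \<not> weighted_regret X T \<theta> (max_payoff F p) (\<lambda>t. x t \<omega>)
          \<le> 3 * sqrt \<Omega> * G * ln (real T) * sqrt (2 * D) / sqrt (real T) + 2 * \<delta>}
    \<le> prob {\<omega> \<in> space M. (\<forall>t\<in>{1..T}. Q t (estimation_draw t \<omega>)) \<and>
              l * (D * v) < (\<Sum>t=1..T. h t (ihat t \<omega>) (J t \<omega>) \<omega>)}"
  proof (rule finite_measure_mono)
    show "{\<omega> \<in> space M. (\<forall>t\<in>{1..T}. Q t (estimation_draw t \<omega>)) \<and>
        l * (D * v) < (\<Sum>t=1..T. h t (ihat t \<omega>) (J t \<omega>) \<omega>)} \<in> events"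
    proof (rule sets.sets_Collect_conj)
      show "{\<omega> \<in> space M. \<forall>t\<in>{1..T}. Q t (estimation_draw t \<omega>)} \<in> events"
        by (rule all_estimation_events_measurable)
      show "{\<omega> \<in> space M. l * (D * v) < (\<Sum>t=1..T. h t (ihat t \<omega>) (J t \<omega>) \<omega>)} \<in> events"
        by (rule borel_measurable_less[OF borel_measurable_const sum_increments_measurable[OF h_meas]])
    qed
  qed (use regret_le E_iff not_le in blast)
  also have "\<dots> \<le> exp ((\<Sum>t=1..T. l\<^sup>2 * (\<alpha> t)\<^sup>2 * (G\<^sup>2 * D)) - l * (D * v))
      * prob {\<omega> \<in> space M. \<forall>t\<in>{1..T}. Q t (estimation_draw t \<omega>)}"
    by (rule tail_on_estimation_events[OF p h_meas h_mgf])
  also have "(\<Sum>t=1..T. l\<^sup>2 * (\<alpha> t)\<^sup>2 * (G\<^sup>2 * D)) = l\<^sup>2 * (c\<^sup>2 * H) * (G\<^sup>2 * D)"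
    by (simp only: sum_distrib_left sum_distrib_right flip: sum_\<alpha>2)
  also have "\<dots> = l\<^sup>2 * D\<^sup>2 * H / \<Omega>"
    unfolding c(2) using G \<Omega> by (simp add: field_simps power2_eq_square)
  also have "l\<^sup>2 * D\<^sup>2 * H / \<Omega> = v\<^sup>2 * \<Omega> / (4 * H)"
    using H D(1) \<Omega> by (simp add: l_def field_simps power2_eq_square)
  also have "l * (D * v) = v\<^sup>2 * \<Omega> / (2 * H)"
    using H D(1) by (simp add: l_def field_simps power2_eq_square)
  \<comment> \<open>this determines the choice of \<open>v\<close>\<close>
  also have "v\<^sup>2 * \<Omega> / (4 * H) - v\<^sup>2 * \<Omega> / (2 * H) = ln 2 - \<Omega>"
    using H \<Omega> by (simp add: v(2) field_simps)
  also have "exp (ln 2 - \<Omega>) = 2 * exp (- \<Omega>)"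
    by (simp add: exp_diff exp_minus divide_inverse)
  finally show ?thesis by (simp only: E_iff)
qed

end

theorem theorem3:
  fixes X :: "'a::euclidean_space set"
    and N :: "'a \<Rightarrow> real"
    and F :: "'m::finite \<Rightarrow> 'n::finite \<Rightarrow> 'a \<Rightarrow> real"
    and Mb :: "'m \<Rightarrow> real"
    and P :: "'m \<Rightarrow> (real ^ 'n) set"
    and p :: "nat \<Rightarrow> 'm \<Rightarrow> real ^ 'n"
    and \<psi> :: "'a \<Rightarrow> real" and d\<psi> :: "'a \<Rightarrow> 'a"
    and G D c \<epsilon> \<Omega> C\<^sub>K :: real
    and w :: "real \<Rightarrow> real"
    and \<alpha> \<theta> :: "nat \<Rightarrow> real"
    and T K :: nat
    and M :: "'w measure" and A B :: "nat \<Rightarrow> 'w measure"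
    and s :: "nat \<Rightarrow> 'm \<Rightarrow> nat \<Rightarrow> 'w \<Rightarrow> 'n"
    and ihat :: "nat \<Rightarrow> 'w \<Rightarrow> 'm"
    and J :: "nat \<Rightarrow> 'w \<Rightarrow> 'n"
    and g x :: "nat \<Rightarrow> 'w \<Rightarrow> 'a"
    and E :: "'w \<Rightarrow> bool"
    and regret :: "'w \<Rightarrow> real"
    and bound :: real
  assumes X: "closed X" "convex X"
    and N: "is_norm N"
    and F_convex: "\<And>i r. convex_on X (F i r)"
    and G_pos: "G > 0"
    and F_lipschitz: "\<And>i r y z. y \<in> X \<Longrightarrow> z \<in> X \<Longrightarrow> \<bar>F i r y - F i r z\<bar> \<le> G * N (y - z)"
    and F_bounded: "\<And>i r y. y \<in> X \<Longrightarrow> \<bar>F i r y\<bar> \<le> Mb i"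
    and P: "\<And>i. P i \<subseteq> prob_simplex" "\<And>i. convex (P i)" "\<And>i. compact (P i)"
    and p: "\<And>t i. t \<in> {1..T} \<Longrightarrow> p t i \<in> P i"
    and \<psi>_gradient: "\<And>y. y \<in> X \<Longrightarrow> (\<psi> has_derivative (\<lambda>h. d\<psi> y \<bullet> h)) (at y within X)"
    and \<psi>_strongly_convex: "strongly_convex_on X N 1 \<psi>"
    and D_finite: "bdd_above ((\<lambda>(y, z). bregman \<psi> d\<psi> y z) ` (X \<times> X))"
    and D_def: "D = (SUP (y, z)\<in>X \<times> X. bregman \<psi> d\<psi> y z)"
    and \<epsilon>: "\<epsilon> > 0"
    and \<Omega>: "\<Omega> \<ge> 1"
    and w_def: "\<And>u. w u = 3 * sqrt u"
    and T: "T \<ge> 2"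
    and K: "K \<ge> 1"
    and c_def: "c = 1 / G * sqrt (D / \<Omega>)"
    and \<alpha>_def: "\<And>t. \<alpha> t = c / sqrt (real t)"
    and \<theta>_def: "\<And>t. \<theta> t = \<alpha> t / (\<Sum>\<tau>=1..T. \<alpha> \<tau>)"
    and smd: "eps_smd M A B X F p T K \<psi> d\<psi> \<alpha> s ihat J g x"
    and g_bounded: "\<And>t \<omega>. t \<in> {1..T} \<Longrightarrow> \<omega> \<in> space M \<Longrightarrow> dual_norm N (g t \<omega>) \<le> G"
    and C\<^sub>K: "C\<^sub>K \<in> {0..<1/2}"
    and E_def: "\<And>\<omega>. E \<omega> \<longleftrightarrow> (\<forall>y\<in>X. \<forall>i. \<forall>t\<in>{1..T}.
          \<bar>sampled_payoff K F s t i y \<omega> - payoff F p t i y\<bar> \<le> C\<^sub>K * \<epsilon> / 2)"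
    and regret_def: "\<And>\<omega>. regret \<omega> =
          weighted_regret X T \<theta> (max_payoff F p) (\<lambda>t. x t \<omega>)"
    and bound_def: "bound =
          w \<Omega> * G * ln (real T) * sqrt (2 * D) / sqrt (real T) + C\<^sub>K * \<epsilon>"
  shows "(\<P>(\<omega> in M. E \<omega>) > 0 \<longrightarrow>
            \<P>(\<omega> in M. regret \<omega> \<le> bound \<bar> E \<omega>) \<ge> 1 - 2 * exp (- \<Omega>)) \<and>
         (\<forall>\<nu>\<^sub>1\<in>{0<..<1}. \<P>(\<omega> in M. E \<omega>) \<ge> 1 - \<nu>\<^sub>1 \<longrightarrow>
            \<P>(\<omega> in M. regret \<omega> \<le> bound) \<ge> 1 - 2 * exp (- \<Omega>) - \<nu>\<^sub>1)"
proof -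
  interpret eps_smd M A B X F p T K \<psi> d\<psi> \<alpha> s ihat J g x by (rule smd)
  have p': "p t i \<in> prob_simplex" if "t \<in> {1..T}" for t i
    using p[OF that] P(1) by blast
  have breg: "bregman \<psi> d\<psi> y z \<le> D" if "y \<in> X" "z \<in> X" for y z
    unfolding D_def using cSUP_upper[OF _ D_finite, of "(y, z)"] that by simp
  obtain \<omega>\<^sub>0 where \<omega>\<^sub>0: "\<omega>\<^sub>0 \<in> space M" using not_empty by blast
  have x\<^sub>1: "x 1 \<omega>\<^sub>0 \<in> X" using \<omega>\<^sub>0 by (intro iterate_in_domain) auto
  have D_nonneg: "0 \<le> D"
    using breg[OF x\<^sub>1 x\<^sub>1] by (simp add: bregman_def)
  have bound_eq: "bound = 3 * sqrt \<Omega> * G * ln (real T) * sqrt (2 * D) / sqrt (real T) + 2 * (C\<^sub>K * \<epsilon> / 2)"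
    by (simp add: bound_def w_def)

  have tail: "prob {\<omega> \<in> space M. E \<omega> \<and> \<not> regret \<omega> \<le> bound} \<le> 2 * exp (- \<Omega>) * prob {\<omega> \<in> space M. E \<omega>}"
  proof (cases "D = 0")
    case True
    \<comment> \<open>the step sizes vanish, and the weights are \<open>0 / 0 = 0\<close>\<close>
    then have "\<theta> t = 0" for t by (simp add: \<theta>_def \<alpha>_def c_def)
    moreover have "X \<noteq> {}" using x\<^sub>1 by blast
    ultimately have "regret \<omega> = 0" for \<omega>
      by (simp add: regret_def weighted_regret_def)
    moreover have "0 \<le> bound" using True C\<^sub>K \<epsilon> by (simp add: bound_def)
    ultimately have "{\<omega> \<in> space M. E \<omega> \<and> \<not> regret \<omega> \<le> bound} = {}" by simp
    then show ?thesis by (simp only: measure_empty) simp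
  next
    case False
    have step: "\<alpha> t = 1 / G * sqrt (D / \<Omega>) / sqrt (real t)" for t
      by (simp only: \<alpha>_def c_def)
    show ?thesis
      unfolding regret_def bound_eq
      by (rule regret_tail_on_estimation_events[OF X N G_pos F_lipschitz p' \<psi>_gradient
            \<psi>_strongly_convex _ breg \<Omega> T step \<theta>_def g_bounded E_def])
         (use False D_nonneg in simp_all)
  qed

  have E_event: "{\<omega> \<in> space M. E \<omega>} \<in> events"
    by (rule accuracy_event_measurable[OF E_def])
  have regret_event: "{\<omega> \<in> space M. regret \<omega> \<le> bound} \<in> events"
  proof -
    have "(\<lambda>\<omega>. max_payoff F p t (x t \<omega>)) \<in> borel_measurable M" if "t \<in> {1..T}" for t
    proof (rule measurable_from_subalg[OF filtration(1)[OF that] borel_measurable_iterate])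
      show "continuous_on X (max_payoff F p t)"
        using F_lipschitz p'[OF that] by (rule continuous_on_max_payoff[OF N G_pos])
    qed (use that in simp)
    then have "regret \<in> borel_measurable M"
      unfolding regret_def weighted_regret_def
      by (intro borel_measurable_diff borel_measurable_sum borel_measurable_times borel_measurable_const)
    then show ?thesis by measurable
  qed
  have split: "prob {\<omega> \<in> space M. regret \<omega> \<le> bound \<and> E \<omega>}
      = prob {\<omega> \<in> space M. E \<omega>} - prob {\<omega> \<in> space M. E \<omega> \<and> \<not> regret \<omega> \<le> bound}"
  proof -
    have "{\<omega> \<in> space M. regret \<omega> \<le> bound \<and> E \<omega>} = {\<omega> \<in> space M. E \<omega>} \<inter> {\<omega> \<in> space M. regret \<omega> \<le> bound}"
      "{\<omega> \<in> space M. E \<omega> \<and> \<not> regret \<omega> \<le> bound} = {\<omega> \<in> space M. E \<omega>} - {\<omega> \<in> space M. regret \<omega> \<le> bound}"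
      by blast+
    then show ?thesis
      using finite_measure_Diff'[OF E_event regret_event] by simp
  qed
  have good: "(1 - 2 * exp (- \<Omega>)) * prob {\<omega> \<in> space M. E \<omega>} \<le> prob {\<omega> \<in> space M. regret \<omega> \<le> bound \<and> E \<omega>}"
    using tail unfolding split by (simp add: left_diff_distrib)
  show ?thesis
  proof (intro conjI impI ballI)
    assume "prob {\<omega> \<in> space M. E \<omega>} > 0"
    with good show "1 - 2 * exp (- \<Omega>) \<le> \<P>(\<omega> in M. regret \<omega> \<le> bound \<bar> E \<omega>)"
      by (simp add: cond_prob_def pos_le_divide_eq)
  next
    fix \<nu>\<^sub>1 :: real
    assume \<nu>: "\<nu>\<^sub>1 \<in> {0<..<1}" and PE: "1 - \<nu>\<^sub>1 \<le> prob {\<omega> \<in> space M. E \<omega>}"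
    \<comment> \<open>\<open>\<Omega> \<ge> 1\<close> makes the conditional guarantee nonnegative, so that it may be multiplied by the lower bound on the probability of \<open>E\<close>\<close>
    have "2 \<le> exp (1::real)" using exp_ge_add_one_self[of "1::real"] by simp
    also have "\<dots> \<le> exp \<Omega>" using \<Omega> by simp
    finally have nonneg: "0 \<le> 1 - 2 * exp (- \<Omega>)" by (simp add: exp_minus divide_simps)
    have "1 - 2 * exp (- \<Omega>) - \<nu>\<^sub>1 \<le> (1 - 2 * exp (- \<Omega>)) * (1 - \<nu>\<^sub>1)"
      using \<nu> by (simp add: algebra_simps)
    also have "\<dots> \<le> (1 - 2 * exp (- \<Omega>)) * prob {\<omega> \<in> space M. E \<omega>}"
      by (rule mult_left_mono[OF PE nonneg])
    also note good
    also have "prob {\<omega> \<in> space M. regret \<omega> \<le> bound \<and> E \<omega>} \<le> prob {\<omega> \<in> space M. regret \<omega> \<le> bound}"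
      using regret_event by (intro finite_measure_mono) auto
    finally show "1 - 2 * exp (- \<Omega>) - \<nu>\<^sub>1 \<le> prob {\<omega> \<in> space M. regret \<omega> \<le> bound}" .
  qed
qed

end
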